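(* Let $P$ be an $n$-polytope and $m\ge 1$. Then $P$ is meek and contains a special $m$-simplex $\Sigma$ if and only if $P$ has an $(n-m)$-dimensional basis polytope $Q$ such that there exist $i\in\mathbb{N}$ (including $0$) and $j\in\mathbb{N}_{>0}$ with $i+j=m$ and $P=\mathrm{pyr}^i(\Sigma_j\oplus Q)$, where $\Sigma_j$ denotes a $j$-simplex and equality is understood up to isomorphism of face lattices. Equivalently, for all $n,m$, the class of meek $n$-polytopes with a special $m$-simplex equals $\{\mathrm{pyr}^i(\Sigma_j\oplus Q) : i,j\in\mathbb{N},\ j\ge 1,\ i+j=m,\ \dim Q=n-m\}$.
   Context: A simplex $\Sigma$ spanned by $m+1$ vertices of a polytope $P$ is a special $m$-simplex of $P$ if every facet of $P$ contains exactly $m$ vertices of $\Sigma$. For an $n$-polytope $P\subset\mathbb{R}^n$ with special $m$-simplex $\Sigma$, the basis polytope $Q$ is the image of $P$ under a linear surjection $\mathbb{R}^n\to\mathbb{R}^{n-m}$ whose kernel is the linear subspace parallel to the affine hull of $\Sigma$. Let $\mathcal{A}$ be the affine hull of the union of all faces of $P$ containing no vertex of $\Sigma$; $P$ is meek if $\dim Q=\dim\mathcal{A}$. Direct sum: for polytopes $P_1\subset\mathbb{R}^a$, $P_2\subset\mathbb{R}^b$, each full-dimensional and containing the origin in its interior, $P_1\oplus P_2=\{\lambda_1(v,0)+\lambda_2(0,w): v\in P_1,w\in P_2,\lambda_1,\lambda_2\ge0,\lambda_1+\lambda_2\le1\}$. The pyramid $\mathrm{pyr}\,R$ over a polytope $R\subset\mathbb{R}^d$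 is $\mathrm{conv}(R\cup\{w\})\subset\mathbb{R}^{d+1}$ with $w\notin\mathbb{R}^d\times\{0\}$; $\mathrm{pyr}^i$ is the $i$-fold iteration, $\mathrm{pyr}^0$ the identity. Two polytopes are isomorphic if their face lattices are isomorphic.
   Formalization: In the equivalence and class equality, "P is meek with a special m-simplex" is read as "P is isomorphic to such a polytope" (a generic octahedron refutes the literal "if"); if no face avoids Σ (P a simplex, n=m), the dimension of the empty affine hull is taken as 0. *)

theory Defs
  imports "HOL-Analysis.Analysis"
begin

text \<open>
  An \<open>n\<close>-polytope is a polytope of affine dimension \<open>n\<close>; it is not required to span the ambient
  Euclidean space. So the copies of \<open>\<real>\<^sup>k\<close> for varying \<open>k\<close> (including \<open>k = 0\<close>) that occur in the
  constructions are rendered as the affine hulls of the polytopes, ``interior'' becomes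
  \<open>rel_interior\<close>, and no dimension has to be a type.
\<close>

definition n_polytope :: "nat \<Rightarrow> 'a::euclidean_space set \<Rightarrow> bool" where
  "n_polytope n P \<longleftrightarrow> polytope P \<and> aff_dim P = int n"

definition vertices :: "'a::euclidean_space set \<Rightarrow> 'a set" where
  "vertices P = {v. v extreme_point_of P}"

definition special_simplex :: "nat \<Rightarrow> 'a::euclidean_space set \<Rightarrow> 'a set \<Rightarrow> bool" where
  "special_simplex m S P \<longleftrightarrow>
     int m simplex S \<and> vertices S \<subseteq> vertices P \<and>
     (\<forall>F. F facet_of P \<longrightarrow> card (vertices S \<inter> F) = m)"

text \<open>
  The target \<open>\<real>\<^sup>n\<^sup>-\<^sup>m\<close> of the linear surjection is identified with the range of \<open>f\<close>, so that
  \<open>n = m\<close> is not excluded. \<open>Q\<close> is unique only up to a linear isomorphism.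
\<close>

definition basis_polytope ::
    "'a::euclidean_space set \<Rightarrow> 'a set \<Rightarrow> 'b::euclidean_space set \<Rightarrow> bool" where
  "basis_polytope P S Q \<longleftrightarrow>
     (\<exists>f. linear f \<and> affine_parallel {x. f x = 0} (affine hull S) \<and> Q = f ` P)"

definition basis_space :: "'a::euclidean_space set \<Rightarrow> 'a set \<Rightarrow> 'a set" where
  "basis_space P S = affine hull (\<Union>{F. F face_of P \<and> vertices S \<inter> F = {}})"

text \<open>
  The basis space is empty exactly when \<open>P\<close> is the special simplex itself (\<open>n = m\<close>, \<open>Q\<close> a point).
  Its dimension is then counted as 0 rather than as the value \<open>-1\<close> of \<open>aff_dim\<close>: the
  classification lists the \<open>m\<close>-simplex, as the iterated pyramid over the direct sum of a simplex
  and a point, among the meek polytopes. In all other cases \<open>max 0\<close> has no effect.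
\<close>

definition meek :: "'a::euclidean_space set \<Rightarrow> 'a set \<Rightarrow> bool" where
  "meek P S \<longleftrightarrow>
     (\<exists>Q :: 'a set. basis_polytope P S Q \<and> aff_dim Q = max 0 (aff_dim (basis_space P S)))"

definition direct_sum ::
    "'a::euclidean_space set \<Rightarrow> 'b::euclidean_space set \<Rightarrow> ('a \<times> 'b) set" where
  "direct_sum P\<^sub>1 P\<^sub>2 =
     {l *\<^sub>R (v, 0) + k *\<^sub>R (0, w) | l k v w.
        v \<in> P\<^sub>1 \<and> w \<in> P\<^sub>2 \<and> 0 \<le> l \<and> 0 \<le> k \<and> l + k \<le> 1}"

text \<open>\<open>is_pyramid R T\<close>: \<open>T\<close> is a pyramid with base \<open>R\<close>.\<close>

definition is_pyramid :: "'a::euclidean_space set \<Rightarrow> 'a set \<Rightarrow> bool" where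
  "is_pyramid R T \<longleftrightarrow> (\<exists>w. w \<notin> affine hull R \<and> T = convex hull (insert w R))"

text \<open>
  \<open>pyr_simplex_sum i j Q R\<close>: \<open>R\<close> realises \<open>pyr\<^sup>i (\<Sigma>\<^sub>j \<oplus> Q)\<close>. The direct sum needs the origin in the
  interior of both summands, so \<open>Q\<close> may be translated first. The construction leaves the choice
  of the simplex, of the translation and of the apices free.
\<close>

definition pyr_simplex_sum ::
    "nat \<Rightarrow> nat \<Rightarrow> 'a::euclidean_space set \<Rightarrow> ('a \<times> 'a) set \<Rightarrow> bool" where
  "pyr_simplex_sum i j Q R \<longleftrightarrow>
     (\<exists>D a. int j simplex D \<and> 0 \<in> rel_interior D \<and> 0 \<in> rel_interior ((+) a ` Q) \<and>
        (is_pyramid ^^ i) (direct_sum D ((+) a ` Q)) R)"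

definition face_lattice_iso ::
    "'a::euclidean_space set \<Rightarrow> 'b::euclidean_space set \<Rightarrow> bool" (infix "\<cong>\<^sub>F" 50) where
  "P \<cong>\<^sub>F R \<longleftrightarrow>
     (\<exists>h. bij_betw h {F. F face_of P} {G. G face_of R} \<and>
        (\<forall>F F'. F face_of P \<longrightarrow> F' face_of P \<longrightarrow> (F \<subseteq> F' \<longleftrightarrow> h F \<subseteq> h F')))"

end

theory Submission
  imports Defs
begin

text \<open>
  Both sides describe one configuration: an affinely independent set \<open>V\<close> (the vertices of the special
  simplex) and a polytope \<open>K\<close>, spanning complementary subspaces, where \<open>0\<close> lies in the relative
  interior of \<open>K\<close> and of the face \<open>conv D\<close> of \<open>conv V\<close>, \<open>D\<close> not being a single vertex. Then
  \<open>P = conv (V \<union> K)\<close> is the iterated pyramid, with apices \<open>V - D\<close>, over the direct sum of \<open>conv D\<close>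
  and \<open>K\<close>. Its faces are the sets \<open>conv (U \<union> G)\<close> with \<open>U \<subseteq> V\<close>, \<open>G\<close> a face of \<open>K\<close> and
  \<open>D \<subseteq> U \<longleftrightarrow> G = K\<close>; speciality, meekness and invariance under combinatorial equivalence are read off
  from this.

  Conversely, every vertex of \<open>P\<close> outside a special simplex \<open>S\<close> is itself a face avoiding \<open>S\<close>, so
  meekness says that these vertices span an affine space of the dimension of \<open>Q\<close>. Their convex hull
  \<open>K\<close> is therefore mapped isomorphically onto \<open>Q\<close>, and it meets \<open>S\<close> in the preimage of the interior
  point of \<open>Q\<close> to which \<open>S\<close> is collapsed.

  For a polytope that is merely combinatorially equivalent to a meek one, the vertices corresponding to
  the special simplex again form one, and the proper faces of its basis polytope correspond to the faces
  avoiding the simplex. So the basis polytope has the face lattice of \<open>K\<close>.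
\<close>

section \<open>Face lattices under linear maps\<close>

text \<open>Stated for arbitrary subsets of ordered types: besides face lattices it is applied to
  the faces avoiding a simplex, with the polytope itself adjoined as greatest element.\<close>

definition order_iso_on :: "'a::order set \<Rightarrow> 'b::order set \<Rightarrow> bool" where
  "order_iso_on A B \<longleftrightarrow>
     (\<exists>h. bij_betw h A B \<and> (\<forall>x\<in>A. \<forall>y\<in>A. x \<le> y \<longleftrightarrow> h x \<le> h y))"

lemma order_iso_onI:
  assumes "\<And>x. x \<in> A \<Longrightarrow> h x \<in> B" "\<And>x. x \<in> A \<Longrightarrow> k (h x) = x"
    and "\<And>y. y \<in> B \<Longrightarrow> k y \<in> A" "\<And>y. y \<in> B \<Longrightarrow> h (k y) = y"
    and "\<And>x x'. x \<in> A \<Longrightarrow> x' \<in> A \<Longrightarrow> x \<le> x' \<Longrightarrow> h x \<le> h x'"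
    and "\<And>y y'. y \<in> B \<Longrightarrow> y' \<in> B \<Longrightarrow> y \<le> y' \<Longrightarrow> k y \<le> k y'"
  shows "order_iso_on A B"
  unfolding order_iso_on_def
proof (intro exI conjI ballI)
  show "bij_betw h A B"
    by (rule bij_betw_byWitness[where f' = k]) (use assms(1-4) in auto)
  show "x \<le> y \<longleftrightarrow> h x \<le> h y" if "x \<in> A" "y \<in> A" for x y
    using assms that by metis
qed

lemma order_iso_onE:
  assumes "order_iso_on A B"
  obtains h k where "\<And>x. x \<in> A \<Longrightarrow> h x \<in> B" "\<And>x. x \<in> A \<Longrightarrow> k (h x) = x"
    "\<And>y. y \<in> B \<Longrightarrow> k y \<in> A" "\<And>y. y \<in> B \<Longrightarrow> h (k y) = y"
    "\<And>x x'. x \<in> A \<Longrightarrow> x' \<in> A \<Longrightarrow> x \<le> x' \<longleftrightarrow> h x \<le> h x'"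
    "\<And>y y'. y \<in> B \<Longrightarrow> y' \<in> B \<Longrightarrow> y \<le> y' \<longleftrightarrow> k y \<le> k y'"
proof -
  obtain h where h: "bij_betw h A B" "\<forall>x\<in>A. \<forall>y\<in>A. x \<le> y \<longleftrightarrow> h x \<le> h y"
    using assms unfolding order_iso_on_def by blast
  let ?k = "inv_into A h"
  have k: "\<And>y. y \<in> B \<Longrightarrow> ?k y \<in> A" "\<And>y. y \<in> B \<Longrightarrow> h (?k y) = y"
    using h(1) by (auto simp: bij_betw_def inv_into_into f_inv_into_f)
  show thesis
  proof (rule that[of h ?k])
    show "\<And>x. x \<in> A \<Longrightarrow> h x \<in> B" "\<And>x. x \<in> A \<Longrightarrow> ?k (h x) = x"
      using h(1) by (auto simp: bij_betw_def)
    show "\<And>y y'. y \<in> B \<Longrightarrow> y' \<in> B \<Longrightarrow> y \<le> y' \<longleftrightarrow> ?k y \<le> ?k y'"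
      using k h(2) by metis
  qed (use h(2) k in blast)+
qed

lemma order_iso_on_sym:
  assumes "order_iso_on A B" shows "order_iso_on B A"
proof (rule order_iso_onE[OF assms])
  fix h k
  assume 1: "\<And>x. x \<in> A \<Longrightarrow> h x \<in> B" and 2: "\<And>x. x \<in> A \<Longrightarrow> k (h x) = x"
    and 3: "\<And>y. y \<in> B \<Longrightarrow> k y \<in> A" and 4: "\<And>y. y \<in> B \<Longrightarrow> h (k y) = y"
    and 5: "\<And>x x'. x \<in> A \<Longrightarrow> x' \<in> A \<Longrightarrow> x \<le> x' \<longleftrightarrow> h x \<le> h x'"
    and 6: "\<And>y y'. y \<in> B \<Longrightarrow> y' \<in> B \<Longrightarrow> y \<le> y' \<longleftrightarrow> k y \<le> k y'"
  show ?thesis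
  proof (rule order_iso_onI[where h = k and k = h])
    show "k y \<in> A" "h (k y) = y" if "y \<in> B" for y using 3 4 that by auto
    show "h x \<in> B" "k (h x) = x" if "x \<in> A" for x using 1 2 that by auto
    show "k y \<le> k y'" if "y \<in> B" "y' \<in> B" "y \<le> y'" for y y'
      using 6[OF that(1,2)] that(3) by (rule iffD1)
    show "h x \<le> h x'" if "x \<in> A" "x' \<in> A" "x \<le> x'" for x x'
      using 5[OF that(1,2)] that(3) by (rule iffD1)
  qed
qed

lemma order_iso_on_trans:
  assumes "order_iso_on A B" "order_iso_on B C" shows "order_iso_on A C"
proof -
  obtain h where h: "bij_betw h A B" and hle: "\<forall>x\<in>A. \<forall>y\<in>A. x \<le> y \<longleftrightarrow> h x \<le> h y"
    using assms(1) unfolding order_iso_on_def by blast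
  obtain k where k: "bij_betw k B C" and kle: "\<forall>x\<in>B. \<forall>y\<in>B. x \<le> y \<longleftrightarrow> k x \<le> k y"
    using assms(2) unfolding order_iso_on_def by blast
  have le: "x \<le> y \<longleftrightarrow> (k \<circ> h) x \<le> (k \<circ> h) y" if "x \<in> A" "y \<in> A" for x y
  proof -
    have "h x \<in> B" "h y \<in> B" using h that by (auto simp: bij_betw_def)
    then have "h x \<le> h y \<longleftrightarrow> k (h x) \<le> k (h y)" by (rule kle[rule_format])
    moreover have "x \<le> y \<longleftrightarrow> h x \<le> h y" using that by (rule hle[rule_format])
    ultimately show ?thesis by simp
  qed
  show ?thesis
    unfolding order_iso_on_def
    by (intro exI[of _ "k \<circ> h"] conjI ballI le bij_betw_trans[OF h k])
qed

lemma face_lattice_iso_iff: "P \<cong>\<^sub>F R \<longleftrightarrow> order_iso_on {F. F face_of P} {G. G face_of R}"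
  unfolding face_lattice_iso_def order_iso_on_def by auto

lemma face_lattice_iso_sym: "P \<cong>\<^sub>F R \<Longrightarrow> R \<cong>\<^sub>F P"
  unfolding face_lattice_iso_iff by (rule order_iso_on_sym)

lemma face_lattice_iso_trans: "P \<cong>\<^sub>F R \<Longrightarrow> R \<cong>\<^sub>F T \<Longrightarrow> P \<cong>\<^sub>F T"
  unfolding face_lattice_iso_iff by (rule order_iso_on_trans)

lemma open_segment_linear_image:
  assumes "linear f" "f a \<noteq> f b"
  shows "f ` open_segment a b = open_segment (f a) (f b)"
proof -
  have "a \<noteq> b" using assms by auto
  then show ?thesis using assms
    by (simp add: open_segment_image_interval image_image linear_add linear_scale)
qed

text \<open>A linear map either collapses a segment to a point or carries its open part onto the
  open segment between the distinct images of the endpoints; in both cases the endpoints are pulled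
  back into the preimage.\<close>

lemma face_of_vimage_Int:
  assumes f: "linear f" and "convex P" and G: "G face_of f ` P"
  shows "(P \<inter> f -` G) face_of P"
  unfolding face_of_def
proof (intro conjI ballI impI)
  show "convex (P \<inter> f -` G)"
    using assms by (simp add: convex_Int convex_linear_vimage face_of_imp_convex)
  fix a b x assume ab: "a \<in> P" "b \<in> P" and x: "x \<in> P \<inter> f -` G" "x \<in> open_segment a b"
  have "a \<in> P \<inter> f -` G \<and> b \<in> P \<inter> f -` G"
  proof (cases "f a = f b")
    case True
    have "x \<in> closed_segment a b" using x by (simp add: open_closed_segment)
    then have "f x \<in> closed_segment (f a) (f b)"
      using closed_segment_linear_image[OF f] by blast
    then show ?thesis using True x ab by auto
  next
    case False
    then have "f x \<in> open_segment (f a) (f b)"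
      using open_segment_linear_image[OF f False] x by blast
    then show ?thesis using face_ofD[OF G] ab x by blast
  qed
  then show "a \<in> P \<inter> f -` G" "b \<in> P \<inter> f -` G" by blast+
qed auto

lemma face_of_inj_on_linear_image:
  assumes f: "linear f" and "convex P" and inj: "inj_on f P" and F: "F face_of P"
  shows "f ` F face_of f ` P"
  unfolding face_of_def
proof (intro conjI ballI impI)
  have sub: "F \<subseteq> P" using F by (rule face_of_imp_subset)
  then show "f ` F \<subseteq> f ` P" by blast
  show "convex (f ` F)" using F f by (simp add: convex_linear_image face_of_imp_convex)
  fix a' b' x' assume "a' \<in> f ` P" "b' \<in> f ` P" "x' \<in> f ` F" and seg: "x' \<in> open_segment a' b'"
  then obtain a b x where abx: "a \<in> P" "b \<in> P" "x \<in> F" "a' = f a" "b' = f b" "x' = f x" by blast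
  have "f a \<noteq> f b" using seg abx by (auto simp: open_segment_def)
  then obtain z where z: "z \<in> open_segment a b" "f z = f x"
    using seg open_segment_linear_image[OF f] abx by (metis imageE)
  have "z \<in> P" using \<open>convex P\<close> z abx by (meson convex_contains_segment in_mono open_closed_segment)
  then have "z = x" using inj z abx sub by (meson inj_onD subsetD)
  then show "a' \<in> f ` F" "b' \<in> f ` F" using face_ofD[OF F] z abx by blast+
qed

lemma face_lattice_iso_linear_image:
  assumes f: "linear f" and P: "convex P" and inj: "inj_on f P"
  shows "P \<cong>\<^sub>F f ` P"
  unfolding face_lattice_iso_iff
proof (rule order_iso_onI[where h = "\<lambda>F. f ` F" and k = "\<lambda>G. P \<inter> f -` G"])
  show "P \<inter> f -` f ` F = F" if "F \<in> {F. F face_of P}" for F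
  proof -
    have "F \<subseteq> P" using that by (simp add: face_of_imp_subset)
    then show ?thesis using inj by (auto simp: inj_on_def)
  qed
  show "f ` (P \<inter> f -` G) = G" if "G \<in> {G. G face_of f ` P}" for G
  proof -
    have "G \<subseteq> f ` P" using that by (simp add: face_of_imp_subset)
    then show ?thesis by auto
  qed
  show "f ` F \<in> {G. G face_of f ` P}" if "F \<in> {F. F face_of P}" for F
    using that face_of_inj_on_linear_image[OF f P inj] by simp
  show "P \<inter> f -` G \<in> {F. F face_of P}" if "G \<in> {G. G face_of f ` P}" for G
    using that face_of_vimage_Int[OF f P] by simp
  show "f ` F \<le> f ` F'" if "F \<le> F'" for F F' using that by (rule image_mono)
  show "P \<inter> f -` G \<le> P \<inter> f -` G'" if "G \<le> G'" for G G' using that by blast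
qed

lemma face_lattice_iso_translation: "P \<cong>\<^sub>F (+) a ` P"
  unfolding face_lattice_iso_iff
  by (rule order_iso_onI[where h = "(`) ((+) a)" and k = "(`) ((+) (- a))"])
     (auto simp: image_image faces_of_translation)

section \<open>Projections, kernels and dimension counts\<close>

text \<open>Complementarity makes addition injective on the product of the two spans; the components
  of a linear left inverse are the two projections.\<close>

lemma proj_complementary_spans:
  fixes A B :: "'a::euclidean_space set"
  assumes "span A \<inter> span B = {0}"
  obtains p q :: "'a \<Rightarrow> 'a" where "linear p" "linear q"
    "\<And>x y. x \<in> span A \<Longrightarrow> y \<in> span B \<Longrightarrow> p (x + y) = x \<and> q (x + y) = y"
proof -
  define s where "s = (\<lambda>z::'a \<times> 'a. fst z + snd z)"
  have s: "linear s"
    unfolding s_def by (intro linear_compose_add linear_fst linear_snd)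
  have sub: "subspace (span A \<times> span B)" by (intro subspace_Times subspace_span)
  have inj: "inj_on s (span A \<times> span B)"
  proof (subst linear_inj_on_iff_eq_0[OF s sub], intro ballI impI)
    fix z assume z: "z \<in> span A \<times> span B" "s z = 0"
    then have "fst z = - snd z" by (simp add: s_def eq_neg_iff_add_eq_0)
    moreover have "fst z \<in> span A" "snd z \<in> span B" using z(1) unfolding mem_Times_iff by blast+
    ultimately have "fst z \<in> span A \<inter> span B" by (metis IntI span_neg)
    then have "fst z = 0" unfolding assms by (rule singletonD)
    then show "z = 0" using \<open>fst z = - snd z\<close> by (simp add: prod_eq_iff)
  qed
  obtain g where g: "linear g" "\<forall>z \<in> span A \<times> span B. g (s z) = z"
    using linear_exists_left_inverse_on[OF s sub inj] by blast
  show thesis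
  proof (rule that[of "fst \<circ> g" "snd \<circ> g"])
    show "linear (fst \<circ> g)" "linear (snd \<circ> g)"
      by (rule linear_compose[OF g(1) linear_fst], rule linear_compose[OF g(1) linear_snd])
    fix x y assume "x \<in> span A" "y \<in> span B"
    then show "(fst \<circ> g) (x + y) = x \<and> (snd \<circ> g) (x + y) = y"
      using g(2)[rule_format, of "(x, y)"] by (simp add: s_def)
  qed
qed

text \<open>Subtracting a projection onto \<open>U\<close> from the identity leaves a map that
  vanishes exactly on \<open>U\<close>. The target is the space itself because \<open>meek\<close>
  asks for a basis polytope in the ambient space of \<open>P\<close>.\<close>

lemma linear_kernel_exists:
  fixes U :: "'a::euclidean_space set"
  assumes "subspace U"
  obtains f :: "'a \<Rightarrow> 'a" where "linear f" "{x. f x = 0} = U"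
proof -
  obtain g :: "'a \<Rightarrow> 'a" where g: "range g \<subseteq> U" "linear g" "\<forall>v\<in>U. g v = v"
    using linear_exists_left_inverse_on[OF linear_id assms] by (auto simp: id_def)
  show thesis
  proof (rule that[of "\<lambda>x. x - g x"])
    show "linear (\<lambda>x. x - g x)" using g(2) by (intro linear_compose_sub linear_ident)
    show "{x. x - g x = 0} = U" using g by force
  qed
qed

text \<open>Rank and nullity relative to a subspace: the part \<open>T\<close> of \<open>U\<close>
  orthogonal to the kernel is mapped injectively and already has the full image, since every vector
  of \<open>U\<close> differs from one in \<open>T\<close> by a kernel vector.\<close>

lemma dim_image_add_dim_kernel:
  fixes f :: "'a::euclidean_space \<Rightarrow> 'b::euclidean_space"
  assumes f: "linear f" and U: "subspace U"
  shows "dim (f ` U) + dim (U \<inter> {x. f x = 0}) = dim U"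
proof -
  let ?N = "U \<inter> {x. f x = 0}"
  define T where "T = {y \<in> U. \<forall>x \<in> ?N. orthogonal x y}"
  have sN: "subspace ?N" using U linear_subspace_kernel[OF f] by (rule subspace_inter)
  have N: "?N \<subseteq> U" by (rule Int_lower1)
  have sT: "subspace T"
    unfolding T_def using subspace_inter[OF U subspace_orthogonal_to_vectors[of ?N]] by (simp add: Int_def)
  have inj: "inj_on f T"
    unfolding linear_inj_on_iff_eq_0[OF f sT] 
    by (auto simp: T_def simp flip: orthogonal_self)
  have "\<exists>z\<in>T. f u = f z" if u: "u \<in> U" for u
  proof -
    obtain y z where yz: "y \<in> span ?N" "\<And>w. w \<in> span ?N \<Longrightarrow> orthogonal z w" "u = y + z"
      using orthogonal_subspace_decomp_exists[of ?N u] by metis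
    have y: "y \<in> ?N" using yz(1) sN by (metis span_eq_iff)
    then have "y \<in> U" using N by (rule subsetD[rotated])
    then have "u - y \<in> U" using U u by (intro subspace_diff)
    then have z: "z \<in> U" using yz(3) by simp
    have "orthogonal x z" if "x \<in> ?N" for x
      using yz(2)[OF span_base[OF that]] by (simp add: orthogonal_commute)
    with z have "z \<in> T" unfolding T_def by simp
    moreover have "f y = 0" using y by simp
    then have "f u = f z" unfolding yz(3) linear_add[OF f] by simp
    ultimately show ?thesis by (rule rev_bexI)
  qed
  then have "f ` U \<subseteq> f ` T" by blast
  moreover have "f ` T \<subseteq> f ` U" unfolding T_def by blast
  ultimately have "f ` U = f ` T" by (rule antisym)
  moreover have "dim (f ` T) = dim T"
    using dim_image_eq[OF f, of T] inj sT by (metis span_eq_iff)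
  ultimately show ?thesis
    using dim_subspace_orthogonal_to_vectors[OF sN U N] unfolding T_def[symmetric]
    by (simp only:)
qed

section \<open>Joins of a simplex and a polytope through a common interior point\<close>

text \<open>The differences of the points of \<open>V\<close> from one of them are linearly
  independent, so values can be prescribed on them; \<open>b\<close> is the constant term of the
  resulting affine function.\<close>

lemma affine_independent_extend:
  fixes V :: "'a::euclidean_space set" and t :: "'a \<Rightarrow> real"
  assumes "\<not> affine_dependent V"
  obtains s :: "'a \<Rightarrow> real" and b where "linear s" "\<And>v. v \<in> V \<Longrightarrow> s v + b = t v"
proof (cases "V = {}")
  case True
  then show thesis using that[of "\<lambda>_. 0" 0] linear_zero by simp
next
  case False
  then obtain v0 where v0: "v0 \<in> V" by blast
  have "independent ((\<lambda>x. - v0 + x) ` (V - {v0}))"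
    using affine_dependent_iff_dependent2[OF v0] assms by simp
  from linear_independent_extend[OF this, of "\<lambda>w. t (w + v0) - t v0"]
  obtain g :: "'a \<Rightarrow> real" where g: "linear g"
    "\<And>w. w \<in> (\<lambda>x. - v0 + x) ` (V - {v0}) \<Longrightarrow> g w = t (w + v0) - t v0" by blast
  show thesis
  proof (rule that[OF g(1)])
    fix v assume v: "v \<in> V"
    show "g v + (t v0 - g v0) = t v"
    proof (cases "v = v0")
      case False
      have "g (- v0 + v) = t (- v0 + v + v0) - t v0"
        by (rule g(2)) (use v False in blast)
      moreover have "g (- v0 + v) = g v - g v0"
        by (simp add: linear_diff[OF g(1)])
      ultimately show ?thesis by simp
    qed simp
  qed
qed

text \<open>An affine function respects affine combinations, so its value at the origin, the
  constant term, is the \<open>c\<close>-weighted sum of the values \<open>t\<close>, which is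
  \<open>0\<close>.\<close>

lemma affine_independent_extend_linear:
  fixes V :: "'a::euclidean_space set" and t c :: "'a \<Rightarrow> real"
  assumes "\<not> affine_dependent V" "sum c V = 1" "(\<Sum>v\<in>V. c v *\<^sub>R v) = 0" "(\<Sum>v\<in>V. c v * t v) = 0"
  obtains s :: "'a \<Rightarrow> real" where "linear s" "\<And>v. v \<in> V \<Longrightarrow> s v = t v"
proof -
  obtain s :: "'a \<Rightarrow> real" and b where s: "linear s" "\<And>v. v \<in> V \<Longrightarrow> s v + b = t v"
    using affine_independent_extend[OF assms(1)] by metis
  have "0 = (\<Sum>v\<in>V. c v * (s v + b))" using assms(4) s(2) by simp
  also have "\<dots> = (\<Sum>v\<in>V. c v * s v) + b"
    by (simp add: distrib_left sum.distrib assms(2) flip: sum_distrib_right)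
  also have "(\<Sum>v\<in>V. c v * s v) = s (\<Sum>v\<in>V. c v *\<^sub>R v)"
    by (simp add: linear_sum[OF s(1)] linear_scale[OF s(1)])
  also have "\<dots> = 0" by (simp add: assms(3) linear_0[OF s(1)])
  finally have "b = 0" by simp
  then show thesis using that[OF s(1)] s(2) by simp
qed

text \<open>The common interior point is placed at the origin, so that affine hulls become spans and
  complementarity is a statement about subspaces. The bound on \<open>card D\<close> encodes
  \<open>j \<ge> 1\<close>; \<open>K = {0}\<close> is allowed and is the case
  \<open>n = m\<close>.\<close>

definition wedge :: "'a::euclidean_space set \<Rightarrow> 'a set \<Rightarrow> 'a set \<Rightarrow> bool" where
  "wedge D V K \<longleftrightarrow>
     \<not> affine_dependent V \<and> D \<subseteq> V \<and> 0 \<in> rel_interior (convex hull D) \<and> 2 \<le> card D \<and>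
     polytope K \<and> 0 \<in> rel_interior K \<and> span V \<inter> span K = {0}"

lemma wedgeD:
  assumes "wedge D V K"
  shows "\<not> affine_dependent V" "finite V" "D \<subseteq> V" "finite D" "\<not> affine_dependent D"
    "0 \<in> rel_interior (convex hull D)" "2 \<le> card D"
    "0 \<in> convex hull D" "0 \<in> convex hull V" "0 \<in> affine hull V" "polytope K" "compact K" "convex K"
    "0 \<in> rel_interior K" "0 \<in> K" "span V \<inter> span K = {0}" "compact (V \<union> K)"
    "polytope (convex hull (V \<union> K))"
proof -
  note w = assms[unfolded wedge_def]
  show V: "\<not> affine_dependent V" "D \<subseteq> V" "2 \<le> card D" "polytope K" "0 \<in> rel_interior K"
    "span V \<inter> span K = {0}" and D0: "0 \<in> rel_interior (convex hull D)" using w by blast+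
  show f: "finite V" "finite D" "\<not> affine_dependent D"
    using V aff_independent_finite affine_independent_subset finite_subset by blast+
  show 0: "0 \<in> convex hull D" using D0 rel_interior_subset by blast
  then show 1: "0 \<in> convex hull V" using hull_mono[OF V(2)] by blast
  then show "0 \<in> affine hull V" using convex_hull_subset_affine_hull by blast
  show K: "compact K" "convex K" "0 \<in> K"
    using V(4,5) polytope_imp_compact polytope_imp_convex rel_interior_subset by blast+
  show "compact (V \<union> K)" using K f by (simp add: compact_Un finite_imp_compact)
  obtain W where W: "finite W" "K = convex hull W" using V(4) unfolding polytope_def by blast
  have "convex hull (V \<union> K) = convex hull (V \<union> W)"
    unfolding W by (rule hull_Un_right[symmetric])
  then show "polytope (convex hull (V \<union> K))"
    using f W by (simp add: polytope_convex_hull)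
qed

lemma wedge_aff_dim:
  assumes "wedge D V K"
  shows "aff_dim (convex hull (V \<union> K)) = int (card V) - 1 + aff_dim K"
proof -
  note w = wedgeD[OF assms]
  have h: "0 \<in> affine hull (V \<union> K)" "0 \<in> affine hull K" using w(15) by (auto intro: hull_inc)
  have "dim (span (V \<union> K)) + dim (span V \<inter> span K) = dim (span V) + dim (span K)"
    unfolding span_Un by (rule dim_sums_Int) auto
  then have "dim (V \<union> K) = dim V + dim K" unfolding w(16) by simp
  moreover have "int (dim V) = int (card V) - 1"
    using w(1,10) aff_dim_zero affine_independent_iff_card by metis
  moreover have "aff_dim (convex hull (V \<union> K)) = int (dim (V \<union> K))" "aff_dim K = int (dim K)"
    using h by (simp_all only: aff_dim_convex_hull aff_dim_zero)
  ultimately show ?thesis by simp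
qed

text \<open>On complementary subspaces a functional can be prescribed separately on \<open>V\<close>
  and on \<open>K\<close>. On \<open>K\<close> there is a supporting functional of \<open>G\<close>;
  on \<open>V\<close> the only constraint is the relation expressing \<open>0\<close> as a convex
  combination of \<open>D\<close>. The condition linking \<open>D\<close> and \<open>G\<close> lets
  both parts attain their maximum at a common level.\<close>

lemma wedge_supporting_functional:
  assumes w: "wedge D V K" and U: "U \<subseteq> V" and G: "G face_of K" and iff: "D \<subseteq> U \<longleftrightarrow> G = K"
  obtains \<phi> :: "'a::euclidean_space \<Rightarrow> real" and \<beta> where "linear \<phi>" "\<And>x. x \<in> V \<union> K \<Longrightarrow> \<phi> x \<le> \<beta>"
    "{x \<in> V \<union> K. \<phi> x = \<beta>} = U \<union> G"
proof -
  note w' = wedgeD[OF w]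
  obtain p q :: "'a \<Rightarrow> 'a" where pq: "linear p" "linear q"
    "\<And>x y. x \<in> span V \<Longrightarrow> y \<in> span K \<Longrightarrow> p (x + y) = x \<and> q (x + y) = y"
    using proj_complementary_spans[OF w'(16)] by metis
  have V: "p v = v" "q v = 0" if "v \<in> V" for v
    using pq(3)[of v 0] that by (auto simp: span_base span_zero)
  have K: "p k = 0" "q k = k" if "k \<in> K" for k
    using pq(3)[of 0 k] that by (auto simp: span_base span_zero)
  obtain c where c: "\<And>x. x \<in> D \<Longrightarrow> 0 < c x" "sum c D = 1" "(\<Sum>x\<in>D. c x *\<^sub>R x) = 0"
    using w'(6) unfolding rel_interior_convex_hull_explicit[OF w'(5)] by blast
  \<comment> \<open>Barycentric coordinates of \<open>0\<close> with respect to all of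
    \<open>V\<close>: positive on \<open>D\<close>, extended by \<open>0\<close>.\<close>
  define d where "d = (\<lambda>x. if x \<in> D then c x else 0)"
  have d: "sum d V = 1" "(\<Sum>x\<in>V. d x *\<^sub>R x) = 0"
  proof -
    have "sum d V = sum c D" unfolding d_def using w'(2,3)
      by (subst sum.inter_restrict[symmetric]) (simp_all add: Int_absorb1)
    then show "sum d V = 1" using c by simp
    have "(\<Sum>x\<in>V. d x *\<^sub>R x) = (\<Sum>x\<in>V. if x \<in> D then c x *\<^sub>R x else 0)"
      by (rule sum.cong) (auto simp: d_def)
    also have "\<dots> = (\<Sum>x\<in>D. c x *\<^sub>R x)" using w'(2,3)
      by (subst sum.inter_restrict[symmetric]) (simp_all add: Int_absorb1)
    finally show "(\<Sum>x\<in>V. d x *\<^sub>R x) = 0" using c by simp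
  qed
  have d0: "0 \<le> d x" for x using c(1) by (simp add: d_def less_imp_le)
  show thesis
  proof (cases "D \<subseteq> U")
    case True
    \<comment> \<open>Here \<open>G = K\<close>, so the functional vanishes on \<open>K\<close> and
      the maximal level is \<open>0\<close>. The relation for \<open>0\<close> is respected because
      its weights vanish off \<open>U\<close>.\<close>
    define t :: "'a \<Rightarrow> real" where "t = (\<lambda>v. if v \<in> U then 0 else - 1)"
    have "d v * t v = 0" if "v \<in> V" for v using True by (auto simp: d_def t_def)
    then have "(\<Sum>v\<in>V. d v * t v) = 0" by (intro sum.neutral) blast
    from affine_independent_extend_linear[OF w'(1) d this]
    obtain s :: "'a \<Rightarrow> real" where s: "linear s" "\<And>v. v \<in> V \<Longrightarrow> s v = t v" by blast
    have \<phi>V: "(s \<circ> p) v = t v" if "v \<in> V" for v using that V s by simp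
    have \<phi>K: "(s \<circ> p) k = 0" if "k \<in> K" for k using that K linear_0[OF s(1)] by simp
    show thesis
    proof (rule that)
      show "linear (s \<circ> p)" by (rule linear_compose[OF pq(1) s(1)])
      show "(s \<circ> p) x \<le> 0" if "x \<in> V \<union> K" for x
        using that \<phi>V[of x] \<phi>K[of x] by (auto simp: t_def split: if_splits)
      show "{x \<in> V \<union> K. (s \<circ> p) x = 0} = U \<union> G"
      proof (intro set_eqI iffI)
        fix x assume x: "x \<in> {x \<in> V \<union> K. (s \<circ> p) x = 0}"
        show "x \<in> U \<union> G"
        proof (cases "x \<in> K")
          case True then show ?thesis using iff \<open>D \<subseteq> U\<close> by blast
        next
          case False
          then show ?thesis using x \<phi>V[of x] by (auto simp: t_def split: if_splits)
        qed
      next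
        fix x assume "x \<in> U \<union> G"
        then show "x \<in> {x \<in> V \<union> K. (s \<circ> p) x = 0}"
          using \<phi>V[of x] \<phi>K[of x] U iff True by (auto simp: t_def)
      qed
    qed
  next
    case False
    then obtain e where e: "e \<in> D" "e \<notin> U" by blast
    define \<tau> where "\<tau> = sum d (V - U)"
    have "d e \<le> \<tau>" unfolding \<tau>_def using e w'(2,3) d0 by (intro member_le_sum) auto
    moreover have "0 < d e" using e c(1) by (simp add: d_def)
    ultimately have \<tau>: "0 < \<tau>" by simp
    \<comment> \<open>\<open>\<tau>\<close> is the total weight of the points outside
      \<open>U\<close>, so lowering the value \<open>1\<close> there by \<open>1 / \<tau>\<close>
      lowers the weighted sum from \<open>1\<close> to \<open>0\<close>, as linearity
      demands.\<close>
    define t :: "'a \<Rightarrow> real" where "t = (\<lambda>v. if v \<in> U then 1 else 1 - 1 / \<tau>)"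
    have "(\<Sum>v\<in>V. d v * t v) = (\<Sum>v\<in>V. d v - (if v \<in> V - U then d v / \<tau> else 0))"
      by (rule sum.cong) (auto simp: t_def algebra_simps)
    also have "\<dots> = 1 - (\<Sum>v\<in>V. if v \<in> V - U then d v / \<tau> else 0)"
      by (simp add: sum_subtractf d)
    also have "(\<Sum>v\<in>V. if v \<in> V - U then d v / \<tau> else 0) = (\<Sum>v\<in>V - U. d v / \<tau>)"
      using w'(2) by (subst sum.inter_restrict[symmetric]) (simp_all add: Int_absorb1)
    also have "\<dots> = 1" using \<tau> by (simp add: \<tau>_def flip: sum_divide_distrib)
    finally have "(\<Sum>v\<in>V. d v * t v) = 0" by simp
    from affine_independent_extend_linear[OF w'(1) d this]
    obtain s :: "'a \<Rightarrow> real" where s: "linear s" "\<And>v. v \<in> V \<Longrightarrow> s v = t v" by blast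
    have "G exposed_face_of K"
      using G exposed_face_of_polyhedron polytope_imp_polyhedron w'(11) by blast
    then obtain a b where ab: "K \<subseteq> {x. a \<bullet> x \<le> b}" "G = K \<inter> {x. a \<bullet> x = b}"
      unfolding exposed_face_of_def by blast
    \<comment> \<open>A proper face misses the relative interior point \<open>0\<close>, so the
      supporting value \<open>b\<close> is positive, and division by it brings the level on
      \<open>G\<close> to \<open>1\<close>, the level chosen on \<open>U\<close>.\<close>
    have "0 \<notin> G"
      using face_of_disjoint_rel_interior[OF G] w'(14) iff False by blast
    then have b: "0 < b" using ab w'(15) by (auto simp: less_le)
    define \<phi> where "\<phi> = (\<lambda>x. s (p x) + (a /\<^sub>R b) \<bullet> q x)"
    have \<phi>V: "\<phi> v = t v" if "v \<in> V" for v using that V s by (simp add: \<phi>_def)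
    have \<phi>K: "\<phi> k = (a \<bullet> k) / b" if "k \<in> K" for k
      using that K linear_0[OF s(1)] by (simp add: \<phi>_def divide_inverse_commute)
    show thesis
    proof (rule that)
      have "linear (\<lambda>x. s (p x))" using linear_compose[OF pq(1) s(1)] by (simp add: comp_def)
      moreover have "linear (\<lambda>x. (a /\<^sub>R b) \<bullet> q x)"
        using linear_compose[OF pq(2) bounded_linear.linear[OF bounded_linear_inner_right, of "a /\<^sub>R b"]]
        by (simp only: comp_def)
      ultimately show "linear \<phi>" unfolding \<phi>_def by (rule linear_compose_add)
      have tle: "t x \<le> 1" "t x = 1 \<longleftrightarrow> x \<in> U" for x using \<tau> by (auto simp: t_def)
      have kle: "\<phi> k \<le> 1" "\<phi> k = 1 \<longleftrightarrow> k \<in> G" if "k \<in> K" for k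
      proof -
        have "a \<bullet> k \<le> b" using ab(1) that by blast
        then show "\<phi> k \<le> 1" using b by (simp add: \<phi>K[OF that])
        show "\<phi> k = 1 \<longleftrightarrow> k \<in> G" using b that by (auto simp: \<phi>K[OF that] ab(2))
      qed
      show "\<phi> x \<le> 1" if "x \<in> V \<union> K" for x
        using that tle(1) kle(1) \<phi>V by auto
      have "G \<subseteq> K" using G by (rule face_of_imp_subset)
      show "{x \<in> V \<union> K. \<phi> x = 1} = U \<union> G"
      proof (intro set_eqI iffI)
        fix x assume "x \<in> {x \<in> V \<union> K. \<phi> x = 1}"
        then show "x \<in> U \<union> G" using kle(2)[of x] tle(2)[of x] \<phi>V[of x] by auto
      next
        fix x assume "x \<in> U \<union> G"
        then show "x \<in> {x \<in> V \<union> K. \<phi> x = 1}"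
          using kle(2)[of x] tle(2)[of x] \<phi>V[of x] U \<open>G \<subseteq> K\<close> by auto
      qed
    qed
  qed
qed

section \<open>The faces of the configuration\<close>

lemma face_of_convex_hull_Int:
  fixes S :: "'a::euclidean_space set"
  assumes "compact S" "F face_of (convex hull S)"
  shows "F = convex hull (F \<inter> S)"
proof -
  obtain S' where S': "S' \<subseteq> S" "F = convex hull S'" using face_of_convex_hull_subset[OF assms] .
  then have "S' \<subseteq> F \<inter> S" using hull_subset by fastforce
  then have "F \<subseteq> convex hull (F \<inter> S)" using S'(2) hull_mono by blast
  moreover have "convex hull (F \<inter> S) \<subseteq> F"
    using assms by (simp add: hull_minimal face_of_imp_convex)
  ultimately show ?thesis by (rule antisym)
qed

text \<open>The supporting functional exposes a face, and a face of a convex hull is spanned by the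
  generators it contains, here exactly those in \<open>U\<close> and \<open>G\<close>.\<close>

lemma wedge_faceI:
  fixes V :: "'a::euclidean_space set"
  assumes w: "wedge D V K" and U: "U \<subseteq> V" and G: "G face_of K" and iff: "D \<subseteq> U \<longleftrightarrow> G = K"
  shows "convex hull (U \<union> G) face_of convex hull (V \<union> K)"
    "convex hull (U \<union> G) \<inter> (V \<union> K) = U \<union> G"
proof -
  obtain \<phi> :: "'a \<Rightarrow> real" and \<beta> where \<phi>: "linear \<phi>" "\<And>x. x \<in> V \<union> K \<Longrightarrow> \<phi> x \<le> \<beta>"
    "{x \<in> V \<union> K. \<phi> x = \<beta>} = U \<union> G"
    using wedge_supporting_functional[OF assms] by metis
  define a where "a = adjoint \<phi> 1"
  have a: "\<phi> x = a \<bullet> x" for x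
    using adjoint_works[OF \<phi>(1), of x 1] by (simp add: a_def inner_commute)
  let ?P = "convex hull (V \<union> K)"
  have "V \<union> K \<subseteq> {x. a \<bullet> x \<le> \<beta>}" using \<phi>(2) unfolding a by blast
  then have "?P \<subseteq> {x. a \<bullet> x \<le> \<beta>}" by (rule hull_minimal) (rule convex_halfspace_le)
  then have F: "(?P \<inter> {x. a \<bullet> x = \<beta>}) face_of ?P"
    by (intro face_of_Int_supporting_hyperplane_le convex_convex_hull) blast
  have sub: "V \<union> K \<subseteq> ?P" by (rule hull_subset)
  have "?P \<inter> {x. a \<bullet> x = \<beta>} \<inter> (V \<union> K) = {x \<in> V \<union> K. \<phi> x = \<beta>}"
    using sub unfolding a by blast
  then have I: "?P \<inter> {x. a \<bullet> x = \<beta>} \<inter> (V \<union> K) = U \<union> G" unfolding \<phi>(3) .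
  have "?P \<inter> {x. a \<bullet> x = \<beta>} = convex hull (U \<union> G)"
    using face_of_convex_hull_Int[OF wedgeD(17)[OF w] F] unfolding I .
  then show "convex hull (U \<union> G) face_of ?P" "convex hull (U \<union> G) \<inter> (V \<union> K) = U \<union> G"
    using F I by simp_all
qed

text \<open>Otherwise \<open>0\<close> would be a vertex of the simplex and at the same time
  relatively interior to the hull of \<open>D\<close>, which would reduce \<open>D\<close> to a
  single point.\<close>

lemma wedge_zero_notin:
  assumes "wedge D V K" shows "0 \<notin> V"
proof
  note w = wedgeD[OF assms]
  assume "0 \<in> V"
  then have "{0} face_of convex hull V"
    using extreme_point_of_convex_hull_affine_independent[OF w(1)] by (simp add: face_of_singleton)
  then have "convex hull D \<subseteq> {0}"
    by (rule subset_of_face_of) (use w(6) hull_mono[OF w(3)] in blast)+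
  then have "D \<subseteq> {0}" by (rule subset_trans[OF hull_subset])
  then have "card D \<le> card {0::'a}" by (rule card_mono[rotated]) simp
  then show False using w(7) by simp
qed

lemma wedge_disjoint:
  assumes "wedge D V K" shows "V \<inter> K = {}"
proof -
  have "x = 0" if "x \<in> V" "x \<in> K" for x
  proof -
    have "x \<in> span V \<inter> span K" using that by (simp add: span_base)
    then show ?thesis unfolding wedgeD(16)[OF assms] by simp
  qed
  then show ?thesis using wedge_zero_notin[OF assms] by blast
qed

lemma wedge_faceI_Int:
  assumes w: "wedge D V K" and U: "U \<subseteq> V" and G: "G face_of K" and iff: "D \<subseteq> U \<longleftrightarrow> G = K"
  shows "convex hull (U \<union> G) \<inter> V = U" "convex hull (U \<union> G) \<inter> K = G"
  using wedge_faceI(2)[OF assms] wedge_disjoint[OF w] U face_of_imp_subset[OF G] by blast+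

text \<open>The origin is relatively interior to both \<open>K\<close> and the hull of
  \<open>D\<close>. A face containing one of these sets contains \<open>0\<close>, and a face that
  meets the relative interior of a subset contains the whole subset, so it contains the other one
  too.\<close>

lemma wedge_faceD:
  assumes w: "wedge D V K" and F: "F face_of convex hull (V \<union> K)"
  shows "F \<inter> K face_of K" "D \<subseteq> F \<inter> V \<longleftrightarrow> F \<inter> K = K" "convex hull ((F \<inter> V) \<union> (F \<inter> K)) = F"
proof -
  note w' = wedgeD[OF w]
  have sub: "V \<subseteq> convex hull (V \<union> K)" "K \<subseteq> convex hull (V \<union> K)"
    using hull_subset[of "V \<union> K" convex] by blast+
  have "convex hull (V \<union> K) \<inter> K = K" using sub by blast
  then show "F \<inter> K face_of K" using face_of_slice[OF F w'(13)] by simp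
  have cD: "convex hull D \<subseteq> convex hull (V \<union> K)" using w'(3) by (intro hull_mono) blast
  have conv: "convex F" using F by (rule face_of_imp_convex)
  have "F \<inter> K = K" if "D \<subseteq> F \<inter> V"
  proof -
    have "convex hull D \<subseteq> F" using that conv by (intro hull_minimal) auto
    then have "K \<subseteq> F" using w'(8,14) by (intro subset_of_face_of[OF F sub(2)]) blast
    then show ?thesis by blast
  qed
  moreover have "D \<subseteq> F \<inter> V" if "F \<inter> K = K"
  proof -
    have "convex hull D \<subseteq> F" using that w'(6,15) by (intro subset_of_face_of[OF F cD]) blast
    then have "D \<subseteq> F" by (rule subset_trans[OF hull_subset])
    then show ?thesis using w'(3) by blast
  qed
  ultimately show "D \<subseteq> F \<inter> V \<longleftrightarrow> F \<inter> K = K" by blast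
  show "convex hull ((F \<inter> V) \<union> (F \<inter> K)) = F"
    using face_of_convex_hull_Int[OF w'(17) F] by (simp add: Int_Un_distrib)
qed

text \<open>Formulated with maximality among proper faces instead of dimension, so that it can be
  applied along an isomorphism of face lattices. If \<open>F\<close> omits \<open>d\<close>,
  adjoining all other points of \<open>V\<close> gives a proper face again, which by maximality is
  \<open>F\<close>.\<close>

lemma wedge_coatom:
  assumes w: "wedge D V K" and F: "F face_of convex hull (V \<union> K)" "F \<noteq> convex hull (V \<union> K)"
    and max: "\<And>F'. F' face_of convex hull (V \<union> K) \<Longrightarrow> F \<subseteq> F' \<Longrightarrow>
                F' \<noteq> convex hull (V \<union> K) \<Longrightarrow> F' = F"
  shows "card (V \<inter> F) = card V - 1"
proof -
  note w' = wedgeD[OF w] and F' = wedge_faceD[OF w F(1)]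
  \<comment> \<open>The omitted point is taken from \<open>D\<close> whenever \<open>F\<close> does
    not contain \<open>K\<close>; then \<open>V - {d}\<close> contains \<open>D\<close> exactly if
    \<open>F\<close> contains \<open>K\<close>, the compatibility condition for a face.\<close>
  have "\<exists>d \<in> V - F. F \<inter> K \<noteq> K \<longrightarrow> d \<in> D"
  proof (cases "F \<inter> K = K")
    case True
    have "\<not> V \<subseteq> F"
    proof
      assume "V \<subseteq> F"
      then have "F \<inter> V = V" by blast
      then show False using F'(3) True F(2) by simp
    qed
    then show ?thesis using True by blast
  next
    case False
    then show ?thesis using F'(2) w'(3) by blast
  qed
  then obtain d where d: "d \<in> V" "d \<notin> F" "F \<inter> K \<noteq> K \<longrightarrow> d \<in> D" by blast
  have iff: "D \<subseteq> V - {d} \<longleftrightarrow> F \<inter> K = K"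
    using d F'(2) w'(3) by blast
  let ?F = "convex hull ((V - {d}) \<union> (F \<inter> K))"
  have face: "?F face_of convex hull (V \<union> K)"
    and int: "?F \<inter> V = V - {d}"
    using wedge_faceI(1)[OF w _ F'(1) iff] wedge_faceI_Int(1)[OF w _ F'(1) iff] by blast+
  have "convex hull ((F \<inter> V) \<union> (F \<inter> K)) \<subseteq> ?F" using d by (intro hull_mono) blast
  then have "F \<subseteq> ?F" unfolding F'(3) .
  moreover have "?F \<noteq> convex hull (V \<union> K)"
    using int d(1) hull_subset[of "V \<union> K" convex] by blast
  ultimately have "?F = F" by (intro max face)
  then have "V \<inter> F = V - {d}" using int by blast
  then show ?thesis using d(1) w'(2) by (simp add: card_Diff_singleton)
qed

section \<open>Speciality, avoiding faces and meekness of the configuration\<close>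

lemma facet_of_maximal:
  fixes P :: "'a::euclidean_space set"
  assumes P: "convex P" and F: "F facet_of P" and F': "F' face_of P" "F \<subseteq> F'" "F' \<noteq> P"
  shows "F' = F"
proof (rule ccontr)
  assume ne: "F' \<noteq> F"
  have "F face_of P" using F by (rule facet_of_imp_face_of)
  then have "F face_of F'" using F'(2) face_of_imp_subset[OF F'(1)] by (rule face_of_subset)
  then have "aff_dim F < aff_dim F'"
    using ne face_of_imp_convex[OF F'(1)] by (intro face_of_aff_dim_lt) auto
  moreover have "aff_dim F' < aff_dim P" using P F'(1,3) by (rule face_of_aff_dim_lt)
  ultimately show False using F by (simp add: facet_of_def)
qed

lemma vertices_convex_hull_affine_independent:
  fixes V :: "'a::euclidean_space set"
  assumes "\<not> affine_dependent V"
  shows "vertices (convex hull V) = V"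
  using extreme_point_of_convex_hull_affine_independent[OF assms] by (simp add: vertices_def)

text \<open>This is the face with \<open>U = {v}\<close> and \<open>G = {}\<close>: as
  \<open>D\<close> has two points and \<open>K\<close> is nonempty, both sides of the compatibility
  condition are false.\<close>

lemma wedge_singleton_face:
  assumes w: "wedge D V K" and v: "v \<in> V"
  shows "{v} face_of convex hull (V \<union> K)"
proof -
  note w' = wedgeD[OF w]
  have "\<not> D \<subseteq> {v}"
  proof
    assume "D \<subseteq> {v}"
    then have "card D \<le> card {v}" by (rule card_mono[rotated]) simp
    then show False using w'(7) by simp
  qed
  then have "D \<subseteq> {v} \<longleftrightarrow> {} = K" using w'(15) by blast
  then show ?thesis using wedge_faceI(1)[OF w _ empty_face_of, of "{v}"] v by simp
qed

lemma wedge_special_simplex: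
  assumes w: "wedge D V K" and m: "card V = Suc m"
  shows "special_simplex m (convex hull V) (convex hull (V \<union> K))"
proof -
  note w' = wedgeD[OF w]
  note vert = vertices_convex_hull_affine_independent[OF w'(1)]
  show ?thesis
    unfolding special_simplex_def vert
  proof (intro conjI allI impI)
    show "int m simplex convex hull V" using w'(1) m by (intro simplex_convex_hull) simp
    show "V \<subseteq> vertices (convex hull (V \<union> K))"
      using wedge_singleton_face[OF w] by (auto simp: vertices_def face_of_singleton)
    fix F assume F: "F facet_of convex hull (V \<union> K)"
    have "card (V \<inter> F) = card V - 1"
    proof (rule wedge_coatom[OF w])
      show "F face_of convex hull (V \<union> K)" using F by (rule facet_of_imp_face_of)
      show "F \<noteq> convex hull (V \<union> K)" using F by auto
      show "F' = F" if "F' face_of convex hull (V \<union> K)" "F \<subseteq> F'" "F' \<noteq> convex hull (V \<union> K)" for F'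
        using facet_of_maximal[OF convex_convex_hull F that] .
    qed
    then show "card (V \<inter> F) = m" using m by simp
  qed
qed

text \<open>Avoiding \<open>V\<close> means \<open>U = {}\<close>; as \<open>D\<close> is nonempty,
  the compatibility condition then reads \<open>G \<noteq> K\<close>.\<close>

lemma wedge_avoiding_face_iff:
  assumes w: "wedge D V K"
  shows "F face_of convex hull (V \<union> K) \<and> V \<inter> F = {} \<longleftrightarrow> F face_of K \<and> F \<noteq> K"
proof -
  note w' = wedgeD[OF w]
  have D: "D \<noteq> {}" using w'(7) by auto
  show ?thesis
  proof (intro iffI conjI; elim conjE)
    assume F: "F face_of convex hull (V \<union> K)" "V \<inter> F = {}"
    note F' = wedge_faceD[OF w F(1)]
    have 0: "F \<inter> V = {}" using F(2) by blast
    have "convex (F \<inter> K)" using F'(1) by (rule face_of_imp_convex)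
    then have "F \<inter> K = F" using F'(3) unfolding 0 by (simp add: hull_same)
    then show "F face_of K" "F \<noteq> K" using F'(1,2) D unfolding 0 by auto
  next
    assume F: "F face_of K" "F \<noteq> K"
    have iff: "D \<subseteq> {} \<longleftrightarrow> F = K" using D F by blast
    have c: "convex hull ({} \<union> F) = F" using face_of_imp_convex[OF F(1)] by (simp add: hull_same)
    show "F face_of convex hull (V \<union> K)" "V \<inter> F = {}"
      using wedge_faceI(1)[OF w empty_subsetI F(1) iff] wedge_faceI_Int(1)[OF w empty_subsetI F(1) iff]
      unfolding c by blast+
  qed
qed

text \<open>The avoiding faces are the proper faces of \<open>K\<close>; the whole polytope stands
  in for the missing top element \<open>K\<close>.\<close>

lemma wedge_avoiding_faces_iso:
  assumes w: "wedge D V K"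
  shows "order_iso_on ({F. F face_of convex hull (V \<union> K) \<and> V \<inter> F = {}} \<union> {convex hull (V \<union> K)})
           {G. G face_of K}"
proof -
  note w' = wedgeD[OF w]
  let ?P = "convex hull (V \<union> K)"
  have P: "?P \<inter> K = K" "K \<subseteq> ?P" using hull_subset[of "V \<union> K" convex] by blast+
  have refl: "K face_of K" using w'(13) by (rule face_of_refl)
  show ?thesis
    unfolding wedge_avoiding_face_iff[OF w]
  proof (rule order_iso_onI[where h = "\<lambda>F. F \<inter> K" and k = "\<lambda>G. if G = K then ?P else G"])
    fix F assume "F \<in> {F. F face_of K \<and> F \<noteq> K} \<union> {?P}"
    then consider "F face_of K" "F \<noteq> K" "F \<inter> K = F" | "F = ?P"
      using face_of_imp_subset by blast
    then show "F \<inter> K \<in> {G. G face_of K}" "(if F \<inter> K = K then ?P else F \<inter> K) = F"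
      using P refl by (cases; simp)+
  next
    fix G assume "G \<in> {G. G face_of K}"
    then have "G face_of K" "G \<inter> K = G" using face_of_imp_subset by blast+
    then show "(if G = K then ?P else G) \<in> {F. F face_of K \<and> F \<noteq> K} \<union> {?P}"
      "(if G = K then ?P else G) \<inter> K = G" using P by auto
  next
    fix G G' assume "G \<in> {G. G face_of K}" "G' \<in> {G. G face_of K}" "G \<subseteq> G'"
    then have "G \<subseteq> K" "G' \<subseteq> K" "G \<subseteq> G'" using face_of_imp_subset by blast+
    then show "(if G = K then ?P else G) \<subseteq> (if G' = K then ?P else G')" using P by auto
  qed blast
qed

text \<open>The map collapses \<open>V\<close> to \<open>0\<close>, already the image of a point of
  \<open>K\<close>, so only \<open>K\<close> contributes to the image; and the kernel meets the span
  of \<open>K\<close> trivially. The basis polytope is thus a faithful copy of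
  \<open>K\<close>.\<close>

lemma wedge_kernel_image:
  assumes w: "wedge D V K" and f: "linear f" "{x. f x = 0} = span V"
  shows "f ` (convex hull (V \<union> K)) = f ` K" "inj_on f (span K)"
    "basis_polytope (convex hull (V \<union> K)) (convex hull V) (f ` K)" "aff_dim (f ` K) = aff_dim K"
proof -
  note w' = wedgeD[OF w]
  have "f v = 0" if "v \<in> V" for v using f(2) span_base[OF that] by blast
  moreover have "0 \<in> f ` K" using w'(15) linear_0[OF f(1)] by force
  ultimately have "f ` (V \<union> K) = f ` K" unfolding image_Un by auto
  moreover have "convex (f ` K)" using w'(13) f(1) by (simp add: convex_linear_image)
  ultimately show *: "f ` (convex hull (V \<union> K)) = f ` K"
    using convex_hull_linear_image[OF f(1), of "V \<union> K"] by (simp add: hull_same)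
  show inj: "inj_on f (span K)"
    unfolding linear_inj_on_iff_eq_0[OF f(1) subspace_span] using f(2) w'(16) by blast
  have "affine hull (convex hull V) = span V"
    using affine_hull_span_0[OF w'(10)] by simp
  then have "affine_parallel {x. f x = 0} (affine hull (convex hull V))"
    unfolding affine_parallel_def f(2) by (intro exI[of _ 0]) simp
  then show "basis_polytope (convex hull (V \<union> K)) (convex hull V) (f ` K)"
    unfolding basis_polytope_def using f(1) * by blast
  have "dim (f ` K) = dim K" using f(1) inj by (rule dim_image_eq)
  moreover have "0 \<in> affine hull (f ` K)" "0 \<in> affine hull K"
    using \<open>0 \<in> f ` K\<close> w'(15) by (auto intro: hull_inc)
  ultimately show "aff_dim (f ` K) = aff_dim K" by (simp only: aff_dim_zero)
qed

lemma wedge_meek: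
  assumes w: "wedge D V K"
  shows "meek (convex hull (V \<union> K)) (convex hull V)"
proof -
  note w' = wedgeD[OF w]
  note vert = vertices_convex_hull_affine_independent[OF w'(1)]
  obtain f :: "'a \<Rightarrow> 'a" where f: "linear f" "{x. f x = 0} = span V"
    using linear_kernel_exists[OF subspace_span] by metis
  let ?B = "basis_space (convex hull (V \<union> K)) (convex hull V)"
  have B: "?B = affine hull \<Union>{F. F face_of K \<and> F \<noteq> K}"
    unfolding basis_space_def vert wedge_avoiding_face_iff[OF w] by simp
  have "max 0 (aff_dim ?B) = aff_dim K"
  \<comment> \<open>A point has no nonempty proper face, so the basis space is empty and its
    dimension \<open>-1\<close> is counted as \<open>0\<close>, the dimension of \<open>K\<close>.
    Otherwise all vertices of \<open>K\<close> are proper faces, and they span its affine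
    hull.\<close>
  proof (cases "K = {0}")
    case True
    have "F = {}" if "F face_of K" "F \<noteq> K" for F
      using that face_of_imp_subset[OF that(1)] unfolding True by blast
    then have "\<Union>{F. F face_of K \<and> F \<noteq> K} = {}" by blast
    then have "?B = {}" unfolding B by simp
    then show ?thesis unfolding True by simp
  next
    case False
    then have ne: "K \<noteq> {x}" for x using w'(15) by blast
    have K: "K = convex hull {x. x extreme_point_of K}"
      using Krein_Milman_Minkowski[OF w'(12,13)] .
    have "{x. x extreme_point_of K} \<subseteq> \<Union>{F. F face_of K \<and> F \<noteq> K}"
    proof
      fix x assume "x \<in> {x. x extreme_point_of K}"
      then have "{x} face_of K" by (simp add: face_of_singleton)
      then show "x \<in> \<Union>{F. F face_of K \<and> F \<noteq> K}" using ne[of x] by blast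
    qed
    then have "affine hull {x. x extreme_point_of K} \<subseteq> ?B" unfolding B by (rule hull_mono)
    moreover have "affine hull {x. x extreme_point_of K} = affine hull K"
      by (subst (2) K) simp
    moreover have "\<Union>{F. F face_of K \<and> F \<noteq> K} \<subseteq> K" using face_of_imp_subset by blast
    then have "?B \<subseteq> affine hull K" unfolding B by (rule hull_mono)
    ultimately have "?B = affine hull K" by blast
    moreover have "0 \<le> aff_dim K"
      using w'(15) aff_dim_subset[of "{0}" K] by simp
    ultimately show ?thesis by simp
  qed
  then show ?thesis
    unfolding meek_def using wedge_kernel_image(3,4)[OF w f] by (intro exI[of _ "f ` K"]) simp
qed

section \<open>Linear images, new apices and the combinatorial type\<close>

lemma wedge_linear_image:
  assumes w: "wedge D V K" and f: "linear f" and inj: "inj_on f (span (V \<union> K))"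
  shows "wedge (f ` D) (f ` V) (f ` K)"
    "convex hull (f ` V \<union> f ` K) = f ` (convex hull (V \<union> K))"
    "card (f ` V) = card V" "inj_on f (convex hull (V \<union> K))"
proof -
  note w' = wedgeD[OF w]
  have injV: "inj_on f (span V)" using inj by (rule inj_on_subset) (intro span_mono Un_upper1)
  have injV': "inj_on f V" using injV span_superset by (rule inj_on_subset)
  then show card: "card (f ` V) = card V" by (rule card_image)
  have "card (f ` D) = card D" using injV' w'(3) by (meson card_image inj_on_subset)
  show hull: "convex hull (f ` V \<union> f ` K) = f ` (convex hull (V \<union> K))"
    by (simp add: convex_hull_linear_image[OF f] image_Un)
  have "convex hull (V \<union> K) \<subseteq> span (V \<union> K)"
    by (rule convex_hull_subset_span)
  then show "inj_on f (convex hull (V \<union> K))" using inj by (rule inj_on_subset[rotated])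
  have f0: "f 0 = 0" using f by (rule linear_0)
  have "int (dim V) = int (card V) - 1"
    using w'(1,10) aff_dim_zero affine_independent_iff_card by metis
  moreover have "dim (f ` V) = dim V" using f injV by (rule dim_image_eq)
  moreover have "0 \<in> affine hull (f ` V)"
  proof -
    have "f ` (affine hull V) = affine hull (f ` V)"
      using f by (intro affine_hull_linear_image) (simp add: linear_conv_bounded_linear)
    then show ?thesis using w'(10) f0 by (metis imageI)
  qed
  ultimately have "aff_dim (f ` V) = int (card (f ` V)) - 1" unfolding card by (simp only: aff_dim_zero)
  then have aff: "\<not> affine_dependent (f ` V)" using w'(2) by (simp add: affine_independent_iff_card)
  have r: "0 \<in> rel_interior (f ` C)" if "convex C" "0 \<in> rel_interior C" for C
    using rel_interior_convex_linear_image[OF f that(1)] that(2) f0 by (metis imageI)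
  have span: "span (f ` V) \<inter> span (f ` K) = {0}"
  proof -
    have "f ` span V \<inter> f ` span K = f ` (span V \<inter> span K)"
      by (rule inj_on_image_Int[OF inj, symmetric]) (intro span_mono, simp)+
    then show ?thesis unfolding w'(16) linear_span_image[OF f] by (simp add: f0)
  qed
  show "wedge (f ` D) (f ` V) (f ` K)"
    unfolding wedge_def
  proof (intro conjI)
    show "f ` D \<subseteq> f ` V" using w'(3) by (rule image_mono)
    show "0 \<in> rel_interior (convex hull (f ` D))"
      using r[OF convex_convex_hull w'(6)] unfolding convex_hull_linear_image[OF f] .
    show "2 \<le> card (f ` D)" using w'(7) \<open>card (f ` D) = card D\<close> by simp
    show "polytope (f ` K)" using f w'(11) by (rule polytope_linear_image)
    show "0 \<in> rel_interior (f ` K)" using r w'(13,14) by blast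
  qed (fact aff span)+
qed

text \<open>The affine hull contains \<open>0\<close> and is a linear span, so the apex adds an
  independent direction to the span of \<open>V\<close>. \<open>D\<close> is unchanged, as the apex
  takes no part in representing \<open>0\<close>.\<close>

lemma wedge_insert:
  assumes w: "wedge D V K" and x: "x \<notin> affine hull (convex hull (V \<union> K))"
  shows "wedge D (insert x V) K" "x \<notin> V"
proof -
  note w' = wedgeD[OF w]
  have x: "x \<notin> span (V \<union> K)"
    using x affine_hull_span_0[of "V \<union> K"] w'(15) by (simp add: hull_inc)
  have sub: "span V \<subseteq> span (V \<union> K)" "span K \<subseteq> span (V \<union> K)" by (intro span_mono; simp)+
  show "x \<notin> V" using x span_base[of x "V \<union> K"] by blast
  have "span (insert x V) \<inter> span K \<subseteq> {0}"
  proof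
    fix y assume y: "y \<in> span (insert x V) \<inter> span K"
    then have yV: "y \<in> span (insert x V)" and yK: "y \<in> span K" by simp_all
    from yV have "\<exists>k. y - k *\<^sub>R x \<in> span V" unfolding span_insert by simp
    then obtain k where k: "y - k *\<^sub>R x \<in> span V" ..
    have "k = 0"
    proof (rule ccontr)
      assume "k \<noteq> 0"
      have "y - (y - k *\<^sub>R x) \<in> span (V \<union> K)"
        using subsetD[OF sub(2) yK] subsetD[OF sub(1) k] by (rule span_diff)
      then have "k *\<^sub>R x \<in> span (V \<union> K)" by simp
      then have "x \<in> span (V \<union> K)" using \<open>k \<noteq> 0\<close> span_scale[of "k *\<^sub>R x" "V \<union> K" "inverse k"] by simp
      then show False using x by blast
    qed
    then have "y \<in> span V \<inter> span K" using k yK by simp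
    then show "y \<in> {0}" unfolding w'(16) .
  qed
  moreover have "0 \<in> span (insert x V) \<inter> span K" by (simp add: span_zero)
  moreover have "x \<notin> affine hull V" using x sub affine_hull_subset_span[of V] by blast
  then have "\<not> affine_dependent (insert x V)" using w'(1) by (intro affine_independent_insert)
  ultimately show "wedge D (insert x V) K"
    unfolding wedge_def using w by (auto simp: wedge_def)
qed

text \<open>A face is described by the pair of \<open>F \<inter> V\<close> and
  \<open>F \<inter> K\<close>. The compatibility condition survives because \<open>\<beta>\<close>
  carries \<open>D\<close> to \<open>D'\<close> and \<open>\<eta>\<close> takes the value
  \<open>K'\<close> at \<open>K\<close> only.\<close>

lemma wedge_face_map:
  assumes w: "wedge D V K" and w': "wedge D' V' K'"
    and \<beta>: "inj_on \<beta> V" "\<beta> ` V = V'" "\<beta> ` D = D'"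
    and \<eta>: "\<And>G. G face_of K \<Longrightarrow> \<eta> G face_of K'" "\<And>G. G face_of K \<Longrightarrow> \<eta> G = K' \<longleftrightarrow> G = K"
    and F: "F face_of convex hull (V \<union> K)"
  defines "F' \<equiv> convex hull (\<beta> ` (F \<inter> V) \<union> \<eta> (F \<inter> K))"
  shows "F' face_of convex hull (V' \<union> K')" "F' \<inter> V' = \<beta> ` (F \<inter> V)" "F' \<inter> K' = \<eta> (F \<inter> K)"
proof -
  note FD = wedge_faceD[OF w F]
  have U: "\<beta> ` (F \<inter> V) \<subseteq> V'" using \<beta>(2) by blast
  have DV: "D \<subseteq> V" using w by (rule wedgeD)
  have "\<beta> ` D \<subseteq> \<beta> ` (F \<inter> V) \<longleftrightarrow> D \<subseteq> F \<inter> V"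
    by (rule inj_on_image_subset_iff[OF \<beta>(1) DV]) simp
  then have iff: "D' \<subseteq> \<beta> ` (F \<inter> V) \<longleftrightarrow> \<eta> (F \<inter> K) = K'"
    unfolding \<beta>(3) using FD(2) \<eta>(2)[OF FD(1)] by (simp only:)
  show "F' face_of convex hull (V' \<union> K')" unfolding F'_def
    by (rule wedge_faceI(1)[OF w' U \<eta>(1)[OF FD(1)] iff])
  show "F' \<inter> V' = \<beta> ` (F \<inter> V)" "F' \<inter> K' = \<eta> (F \<inter> K)" unfolding F'_def
    by (rule wedge_faceI_Int[OF w' U \<eta>(1)[OF FD(1)] iff])+
qed

lemma order_iso_on_top:
  assumes "order_iso_on {F. F face_of P} {G. G face_of R}" "convex P" "convex R"
  obtains h k where "\<And>F. F face_of P \<Longrightarrow> h F face_of R" "\<And>F. F face_of P \<Longrightarrow> k (h F) = F"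
    "\<And>G. G face_of R \<Longrightarrow> k G face_of P" "\<And>G. G face_of R \<Longrightarrow> h (k G) = G"
    "\<And>F F'. F face_of P \<Longrightarrow> F' face_of P \<Longrightarrow> F \<subseteq> F' \<longleftrightarrow> h F \<subseteq> h F'"
    "\<And>G G'. G face_of R \<Longrightarrow> G' face_of R \<Longrightarrow> G \<subseteq> G' \<longleftrightarrow> k G \<subseteq> k G'"
    "h P = R" "k R = P" "h {} = {}"
proof (rule order_iso_onE[OF assms(1)])
  fix h k
  assume *: "\<And>x. x \<in> {F. F face_of P} \<Longrightarrow> h x \<in> {G. G face_of R}"
    "\<And>x. x \<in> {F. F face_of P} \<Longrightarrow> k (h x) = x"
    "\<And>y. y \<in> {G. G face_of R} \<Longrightarrow> k y \<in> {F. F face_of P}"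
    "\<And>y. y \<in> {G. G face_of R} \<Longrightarrow> h (k y) = y"
    and h: "\<And>x x'. x \<in> {F. F face_of P} \<Longrightarrow> x' \<in> {F. F face_of P} \<Longrightarrow> x \<subseteq> x' \<longleftrightarrow> h x \<subseteq> h x'"
    and k: "\<And>y y'. y \<in> {G. G face_of R} \<Longrightarrow> y' \<in> {G. G face_of R} \<Longrightarrow> y \<subseteq> y' \<longleftrightarrow> k y \<subseteq> k y'"
  note * = *[unfolded mem_Collect_eq] and h = h[unfolded mem_Collect_eq] and k = k[unfolded mem_Collect_eq]
  have P: "P face_of P" and R: "R face_of R" using assms(2,3) by (simp_all add: face_of_refl)
  have "R \<subseteq> h P"
  proof -
    have "k R \<subseteq> P" by (rule face_of_imp_subset[OF *(3)[OF R]])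
    then have "h (k R) \<subseteq> h P" by (rule iffD1[OF h[OF *(3)[OF R] P]])
    then show ?thesis by (simp only: *(4)[OF R])
  qed
  moreover have "h P \<subseteq> R" by (rule face_of_imp_subset[OF *(1)[OF P]])
  ultimately have hP: "h P = R" by (intro antisym)
  have kR: "k R = P" using *(2)[OF P] by (simp only: hP)
  have e: "{} face_of P" "{} face_of R" by simp_all
  have "h {} \<subseteq> h (k {})" by (rule iffD1[OF h[OF e(1) *(3)[OF e(2)]]]) simp
  then have h0: "h {} = {}" by (simp add: *(4)[OF e(2)])
  show thesis by (rule that[OF * h k hP kR h0])
qed

text \<open>Faces correspond to compatible pairs of a subset of \<open>V\<close> and a face of
  \<open>K\<close>, so only the sizes of \<open>D\<close> and \<open>V\<close> and the face lattice
  of \<open>K\<close> matter. The bijection of the vertices is glued from one on \<open>D\<close>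
  and one on \<open>V - D\<close>.\<close>

lemma wedge_face_lattice_iso:
  assumes w: "wedge D V K" and w': "wedge D' V' K'"
    and card: "card D = card D'" "card V = card V'" and iso: "K \<cong>\<^sub>F K'"
  shows "convex hull (V \<union> K) \<cong>\<^sub>F convex hull (V' \<union> K')"
proof -
  note W = wedgeD[OF w] and W' = wedgeD[OF w']
  obtain \<beta>1 where \<beta>1: "bij_betw \<beta>1 D D'" using finite_same_card_bij[OF W(4) W'(4) card(1)] by blast
  have "card (V - D) = card (V' - D')"
    using card W(3,4) W'(3,4) by (simp add: card_Diff_subset)
  then obtain \<beta>2 where \<beta>2: "bij_betw \<beta>2 (V - D) (V' - D')"
    using finite_same_card_bij W(2) W'(2) by (metis finite_Diff)
  define \<beta> where "\<beta> = (\<lambda>x. if x \<in> D then \<beta>1 x else \<beta>2 x)"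
  have D: "bij_betw \<beta> D D'" using \<beta>1 by (rule bij_betw_cong[THEN iffD1, rotated]) (simp add: \<beta>_def)
  have "bij_betw \<beta> (V - D) (V' - D')"
    using \<beta>2 by (rule bij_betw_cong[THEN iffD1, rotated]) (simp add: \<beta>_def)
  then have "bij_betw \<beta> (D \<union> (V - D)) (D' \<union> (V' - D'))"
    by (rule bij_betw_combine[OF D]) simp
  then have V: "bij_betw \<beta> V V'" using W(3) W'(3) by (simp add: Un_absorb1)
  define \<gamma> where "\<gamma> = inv_into V \<beta>"
  have \<beta>: "inj_on \<beta> V" "\<beta> ` V = V'" "\<beta> ` D = D'" using V D by (simp_all add: bij_betw_def)
  have \<gamma>: "inj_on \<gamma> V'" "\<gamma> ` V' = V"
    using bij_betw_inv_into[OF V] by (simp_all add: bij_betw_def \<gamma>_def)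
  have \<gamma>\<beta>: "\<gamma> ` \<beta> ` U = U" if "U \<subseteq> V" for U
    unfolding \<gamma>_def using \<beta>(1) that by (rule inv_into_image_cancel)
  have \<beta>\<gamma>: "\<beta> ` \<gamma> ` U = U" if "U \<subseteq> V'" for U
    unfolding \<gamma>_def using \<beta>(2) that by (rule image_inv_into_cancel)
  have \<gamma>D: "\<gamma> ` D' = D" using \<gamma>\<beta>[OF W(3)] by (simp only: \<beta>(3))
  show ?thesis
  proof (rule order_iso_on_top[OF iso[unfolded face_lattice_iso_iff] W(13) W'(13)])
    fix h k
    assume h: "\<And>F. F face_of K \<Longrightarrow> h F face_of K'" "\<And>F. F face_of K \<Longrightarrow> k (h F) = F"
      and k: "\<And>G. G face_of K' \<Longrightarrow> k G face_of K" "\<And>G. G face_of K' \<Longrightarrow> h (k G) = G"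
      and hm: "\<And>F F'. F face_of K \<Longrightarrow> F' face_of K \<Longrightarrow> F \<subseteq> F' \<longleftrightarrow> h F \<subseteq> h F'"
      and km: "\<And>G G'. G face_of K' \<Longrightarrow> G' face_of K' \<Longrightarrow> G \<subseteq> G' \<longleftrightarrow> k G \<subseteq> k G'"
      and top: "h K = K'" "k K' = K"
    have ht: "h G = K' \<longleftrightarrow> G = K" if "G face_of K" for G by (metis h(2)[OF that] top)
    have kt: "k G = K \<longleftrightarrow> G = K'" if "G face_of K'" for G by (metis k(2)[OF that] top)
    let ?P = "convex hull (V \<union> K)" and ?P' = "convex hull (V' \<union> K')"
    define H where "H = (\<lambda>F. convex hull (\<beta> ` (F \<inter> V) \<union> h (F \<inter> K)))"
    define L where "L = (\<lambda>F. convex hull (\<gamma> ` (F \<inter> V') \<union> k (F \<inter> K')))"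
    have H: "H F face_of ?P'" "H F \<inter> V' = \<beta> ` (F \<inter> V)" "H F \<inter> K' = h (F \<inter> K)" if "F face_of ?P" for F
      unfolding H_def by (rule wedge_face_map[OF w w' \<beta> h(1) ht that]; assumption)+
    have L: "L F face_of ?P" "L F \<inter> V = \<gamma> ` (F \<inter> V')" "L F \<inter> K = k (F \<inter> K')" if "F face_of ?P'" for F
      unfolding L_def by (rule wedge_face_map[OF w' w \<gamma> \<gamma>D k(1) kt that]; assumption)+
    show ?thesis
      unfolding face_lattice_iso_iff
    proof (rule order_iso_onI[where h = H and k = L]; unfold mem_Collect_eq)
      fix F assume F: "F face_of ?P"
      show "H F face_of ?P'" using H(1)[OF F] .
      have "L (H F) = convex hull (\<gamma> ` \<beta> ` (F \<inter> V) \<union> k (h (F \<inter> K)))"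
        unfolding L_def H(2)[OF F] H(3)[OF F] ..
      also have "\<dots> = convex hull ((F \<inter> V) \<union> (F \<inter> K))"
        by (simp add: \<gamma>\<beta> h(2)[OF wedge_faceD(1)[OF w F]])
      also have "\<dots> = F" by (rule wedge_faceD(3)[OF w F])
      finally show "L (H F) = F" .
    next
      fix F assume F: "F face_of ?P'"
      show "L F face_of ?P" using L(1)[OF F] .
      have "H (L F) = convex hull (\<beta> ` \<gamma> ` (F \<inter> V') \<union> h (k (F \<inter> K')))"
        unfolding H_def L(2)[OF F] L(3)[OF F] ..
      also have "\<dots> = convex hull ((F \<inter> V') \<union> (F \<inter> K'))"
        by (simp add: \<beta>\<gamma> k(2)[OF wedge_faceD(1)[OF w' F]])
      also have "\<dots> = F" by (rule wedge_faceD(3)[OF w' F])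
      finally show "H (L F) = F" .
    next
      fix F F' assume F: "F face_of ?P" "F' face_of ?P" "F \<subseteq> F'"
      have "h (F \<inter> K) \<subseteq> h (F' \<inter> K)"
        using F(3) by (intro iffD1[OF hm[OF wedge_faceD(1)[OF w F(1)] wedge_faceD(1)[OF w F(2)]]]) blast
      then show "H F \<subseteq> H F'" unfolding H_def using F(3) by (intro hull_mono) blast
    next
      fix F F' assume F: "F face_of ?P'" "F' face_of ?P'" "F \<subseteq> F'"
      have "k (F \<inter> K') \<subseteq> k (F' \<inter> K')"
        using F(3) by (intro iffD1[OF km[OF wedge_faceD(1)[OF w' F(1)] wedge_faceD(1)[OF w' F(2)]]]) blast
      then show "L F \<subseteq> L F'" unfolding L_def using F(3) by (intro hull_mono) blast
    qed
  qed
qed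

section \<open>Iterated pyramids over direct sums\<close>

lemma direct_sum_eq_convex_hull:
  assumes "convex A" "convex B" "0 \<in> A" "0 \<in> B"
  shows "direct_sum A B = convex hull (A \<times> {0} \<union> {0} \<times> B)"
proof
  show "direct_sum A B \<subseteq> convex hull (A \<times> {0} \<union> {0} \<times> B)"
  proof
    fix x assume "x \<in> direct_sum A B"
    then obtain l k v w where x: "x = l *\<^sub>R (v, 0) + k *\<^sub>R (0, w)" "v \<in> A" "w \<in> B" "0 \<le> l" "0 \<le> k" "l + k \<le> 1"
      unfolding direct_sum_def by blast
    \<comment> \<open>The remaining weight is put on the origin, which belongs to both
      summands.\<close>
    have "x = l *\<^sub>R (v, 0) + k *\<^sub>R (0, w) + (1 - l - k) *\<^sub>R (0, 0)" using x by simp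
    then have "x \<in> convex hull {(v, 0), (0, w), (0, 0)}"
      unfolding convex_hull_3 mem_Collect_eq
      by (intro exI[of _ l] exI[of _ k] exI[of _ "1 - l - k"]) (use x in auto)
    also have "\<dots> \<subseteq> convex hull (A \<times> {0} \<union> {0} \<times> B)"
      using x assms by (intro hull_mono) auto
    finally show "x \<in> convex hull (A \<times> {0} \<union> {0} \<times> B)" .
  qed
  have un: "convex hull (A \<times> {0} \<union> {0} \<times> B) =
      {l *\<^sub>R x + k *\<^sub>R y | l k x y. 0 \<le> l \<and> 0 \<le> k \<and> l + k = 1 \<and> x \<in> A \<times> {0} \<and> y \<in> {0} \<times> B}"
    using assms by (intro convex_hull_union_two) (auto intro: convex_Times)
  show "convex hull (A \<times> {0} \<union> {0} \<times> B) \<subseteq> direct_sum A B"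
  proof
    fix z assume "z \<in> convex hull (A \<times> {0} \<union> {0} \<times> B)"
    then obtain l k x y where z: "z = l *\<^sub>R x + k *\<^sub>R y" "0 \<le> l" "0 \<le> k" "l + k = 1"
      "x \<in> A \<times> {0}" "y \<in> {0} \<times> B" unfolding un by blast
    then have "z = l *\<^sub>R (fst x, 0) + k *\<^sub>R (0, snd y)" "fst x \<in> A" "snd y \<in> B" by auto
    then show "z \<in> direct_sum A B"
      unfolding direct_sum_def mem_Collect_eq using z(2-4) by (metis order_refl)
  qed
qed

lemma wedge_product:
  fixes V :: "'a::euclidean_space set" and K :: "'b::euclidean_space set"
  assumes V: "\<not> affine_dependent V" "D \<subseteq> V" "0 \<in> rel_interior (convex hull D)" "2 \<le> card D"
    and K: "polytope K" "0 \<in> rel_interior K"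
  shows "wedge (D \<times> {0}) (V \<times> {0}) ({0} \<times> K)"
proof -
  define f g where "f = (\<lambda>x::'a. (x, 0::'b))" and "g = (\<lambda>y::'b. (0::'a, y))"
  have f: "linear f" "inj f" and g: "linear g"
    by (auto simp: f_def g_def linear_iff inj_def)
  have im: "S \<times> {0} = f ` S" "{0} \<times> T = g ` T" for S T by (auto simp: f_def g_def)
  have fin: "finite V" using V(1) by (rule aff_independent_finite)
  have card: "card (f ` S) = card S" for S using f(2) by (simp add: card_image inj_on_subset)
  have r: "0 \<in> rel_interior (h ` C)" if "linear h" "convex C" "0 \<in> rel_interior C"
    for h :: "'c::euclidean_space \<Rightarrow> 'a \<times> 'b" and C
    using rel_interior_convex_linear_image[OF that(1,2)] that(3) linear_0[OF that(1)] by (metis imageI)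
  show ?thesis
    unfolding wedge_def im
  proof (intro conjI)
    have "aff_dim (f ` V) = aff_dim V" using f by (rule aff_dim_injective_linear_image)
    then show "\<not> affine_dependent (f ` V)"
      using V(1) fin by (simp add: affine_independent_iff_card card)
    show "f ` D \<subseteq> f ` V" using V(2) by (rule image_mono)
    show "0 \<in> rel_interior (convex hull f ` D)"
      using r[OF f(1) convex_convex_hull V(3)] unfolding convex_hull_linear_image[OF f(1)] .
    show "2 \<le> card (f ` D)" using V(4) card by simp
    show "polytope (g ` K)" using g K(1) by (rule polytope_linear_image)
    show "0 \<in> rel_interior (g ` K)"
      using r[OF g polytope_imp_convex[OF K(1)] K(2)] .
    have "f ` span V \<inter> g ` span K \<subseteq> {0}" by (auto simp: f_def g_def zero_prod_def)
    moreover have "0 \<in> span (f ` V) \<inter> span (g ` K)" by (simp add: span_zero)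
    ultimately show "span (f ` V) \<inter> span (g ` K) = {0}"
      unfolding linear_span_image[OF f(1)] linear_span_image[OF g] by blast
  qed
qed

text \<open>Every apex is appended to \<open>V\<close> while \<open>D\<close> and \<open>K\<close>
  stay fixed, so iterated pyramids are configurations of the same kind.\<close>

lemma wedge_is_pyramid_relpowp:
  assumes "wedge D V K" "(is_pyramid ^^ i) (convex hull (V \<union> K)) R"
  shows "\<exists>V'. wedge D V' K \<and> R = convex hull (V' \<union> K) \<and> card V' = card V + i"
  using assms(2)
proof (induction i arbitrary: R)
  case 0
  then have "R = convex hull (V \<union> K)" by simp
  then show ?case using assms(1) by (intro exI[of _ V]) simp
next
  case (Suc i)
  then obtain R' where R': "(is_pyramid ^^ i) (convex hull (V \<union> K)) R'" "is_pyramid R' R"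
    by (auto elim: relpowp_Suc_E)
  obtain V' where V': "wedge D V' K" "R' = convex hull (V' \<union> K)" "card V' = card V + i"
    using Suc.IH[OF R'(1)] by blast
  obtain x where x: "x \<notin> affine hull R'" "R = convex hull (insert x R')"
    using R'(2) unfolding is_pyramid_def by blast
  note ins = wedge_insert[OF V'(1) x(1)[unfolded V'(2)]]
  have "R = convex hull (insert x (V' \<union> K))"
    unfolding x(2) V'(2) by (rule hull_insert[symmetric])
  then have "R = convex hull (insert x V' \<union> K)" by simp
  moreover have "card (insert x V') = card V + Suc i"
    using ins(2) wedgeD(2)[OF V'(1)] V'(3) by simp
  ultimately show ?case using ins(1) by blast
qed

lemma wedge_subset:
  assumes "wedge D V K" "D \<subseteq> V'" "V' \<subseteq> V"
  shows "wedge D V' K"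
proof -
  note w = wedgeD[OF assms(1)]
  have "span V' \<inter> span K \<subseteq> {0}" using span_mono[OF assms(3)] unfolding w(16)[symmetric] by blast
  moreover have "0 \<in> span V' \<inter> span K" by (simp add: span_zero)
  ultimately have "span V' \<inter> span K = {0}" by (intro antisym) simp_all
  moreover have "\<not> affine_dependent V'" using w(1) assms(3) by (rule affine_independent_subset)
  ultimately show ?thesis unfolding wedge_def using w assms(2) by simp
qed

lemma wedge_iterated_pyramid:
  assumes "wedge D (D \<union> E) K" "finite E" "D \<inter> E = {}"
  shows "(is_pyramid ^^ card E) (convex hull (D \<union> K)) (convex hull (D \<union> E \<union> K))"
  using assms(2,1,3)
proof (induction E rule: finite_induct)
  case empty
  then show ?case by simp
next
  case (insert e E)
  let ?V = "D \<union> insert e E" and ?V' = "D \<union> E"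
  note w = wedgeD[OF insert.prems(1)]
  have w': "wedge D ?V' K" using wedge_subset[OF insert.prems(1)] by blast
  have IH: "(is_pyramid ^^ card E) (convex hull (D \<union> K)) (convex hull (?V' \<union> K))"
    using insert.IH[OF w'] insert.prems(2) by blast
  have e: "e \<notin> affine hull ?V'"
  proof
    assume a: "e \<in> affine hull ?V'"
    have "e \<notin> ?V'" using insert by blast
    then have "?V - {e} = ?V'" by blast
    then show False using w(1) a unfolding affine_dependent_def by (metis Un_iff insertI1)
  qed
  \<comment> \<open>Splitting \<open>e\<close> along the complementary spans, its part in the span
    of \<open>K\<close> also lies in the span of the simplex and vanishes. So \<open>e\<close> would
    lie in the span of the other points, which is their affine hull.\<close>
  have "e \<notin> affine hull (convex hull (?V' \<union> K))"
  proof
    assume "e \<in> affine hull (convex hull (?V' \<union> K))"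
    then have "e \<in> span (?V' \<union> K)" using affine_hull_subset_span by auto
    then obtain x y where xy: "e = x + y" "x \<in> span ?V'" "y \<in> span K" unfolding span_Un[of ?V' K] by blast
    have "x \<in> span ?V" using xy(2) span_mono[of ?V' ?V] by blast
    moreover have "e \<in> span ?V" by (simp add: span_base)
    ultimately have "e - x \<in> span ?V" by (rule span_diff[rotated])
    then have "y \<in> span ?V \<inter> span K" using xy by simp
    then have "y = 0" unfolding w(16) by simp
    then have "e \<in> span ?V'" using xy by simp
    then show False using e affine_hull_span_0[OF wedgeD(10)[OF w']] by simp
  qed
  then have "is_pyramid (convex hull (?V' \<union> K)) (convex hull (?V \<union> K))"
    unfolding is_pyramid_def
    using hull_insert[of convex e "?V' \<union> K"] by (intro exI[of _ e]) simp
  then show ?case using insert.hyps relpowp_Suc_I[OF IH] by simp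
qed

lemma pyr_simplex_sum_imp_wedge:
  fixes Q :: "'a::euclidean_space set"
  assumes "pyr_simplex_sum i j Q R" "polytope Q" "0 < j"
  obtains D V a where "wedge D V ({0} \<times> (+) a ` Q)" "R = convex hull (V \<union> {0} \<times> (+) a ` Q)"
    "card D = Suc j" "card V = Suc (i + j)"
proof -
  obtain S a where S: "int j simplex S" "0 \<in> rel_interior S" "0 \<in> rel_interior ((+) a ` Q)"
    and R: "(is_pyramid ^^ i) (direct_sum S ((+) a ` Q)) R"
    using assms(1) unfolding pyr_simplex_sum_def by blast
  obtain C where C: "\<not> affine_dependent C" "int (card C) = int j + 1" "S = convex hull C"
    using S(1) unfolding simplex_def by blast
  let ?K = "(+) a ` Q"
  have K: "polytope ?K" using assms(2) by (simp add: polytope_translation_eq)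
  have w: "wedge (C \<times> {0}) (C \<times> {0}) ({0} \<times> ?K)"
    using C S assms(3) K by (intro wedge_product) auto
  have "0 \<in> S" "0 \<in> ?K" using S rel_interior_subset by blast+
  then have "direct_sum S ?K = convex hull (S \<times> {0} \<union> {0} \<times> ?K)"
    using C(3) polytope_imp_convex[OF K] by (intro direct_sum_eq_convex_hull) simp_all
  also have "S \<times> {0} = convex hull (C \<times> {0::'a})" unfolding C(3) by (simp add: convex_hull_Times)
  also have "convex hull (convex hull (C \<times> {0::'a}) \<union> {0} \<times> ?K) = convex hull (C \<times> {0} \<union> {0} \<times> ?K)"
    by (rule hull_Un_left[symmetric])
  finally have "(is_pyramid ^^ i) (convex hull (C \<times> {0} \<union> {0} \<times> ?K)) R" using R by simp
  from wedge_is_pyramid_relpowp[OF w this] obtain V where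
    "wedge (C \<times> {0}) V ({0} \<times> ?K)" "R = convex hull (V \<union> {0} \<times> ?K)" "card V = card (C \<times> {0::'a}) + i"
    by blast
  moreover have "card (C \<times> {0::'a}) = Suc j" using C(2) by (simp add: card_cartesian_product)
  ultimately show thesis using that by simp
qed

lemma wedge_product_pyr_simplex_sum:
  fixes V Q :: "'a::euclidean_space set"
  assumes V: "\<not> affine_dependent V" "D \<subseteq> V" "0 \<in> rel_interior (convex hull D)" "2 \<le> card D"
    and Q: "polytope Q" "0 \<in> rel_interior ((+) a ` Q)"
  shows "pyr_simplex_sum (card (V - D)) (card D - 1) Q (convex hull (V \<times> {0} \<union> {0} \<times> (+) a ` Q))"
proof -
  let ?K = "(+) a ` Q"
  have K: "polytope ?K" using Q(1) by (simp add: polytope_translation_eq)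
  have w: "wedge (D \<times> {0}) (V \<times> {0}) ({0} \<times> ?K)" by (rule wedge_product[OF V K Q(2)])
  have fin: "finite V" using V(1) by (rule aff_independent_finite)
  have eq: "D \<times> {0} \<union> (V - D) \<times> {0} = V \<times> {0::'a}" using V(2) by blast
  have "(is_pyramid ^^ card ((V - D) \<times> {0::'a})) (convex hull (D \<times> {0} \<union> {0} \<times> ?K))
      (convex hull (D \<times> {0} \<union> (V - D) \<times> {0} \<union> {0} \<times> ?K))"
    using w fin by (intro wedge_iterated_pyramid) (auto simp: eq)
  then have pyr: "(is_pyramid ^^ card (V - D)) (convex hull (D \<times> {0} \<union> {0} \<times> ?K))
      (convex hull (V \<times> {0} \<union> {0} \<times> ?K))"
    unfolding eq by (simp add: card_cartesian_product)
  have "0 \<in> convex hull D" "0 \<in> ?K" using V(3) Q(2) rel_interior_subset by blast+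
  then have "direct_sum (convex hull D) ?K = convex hull ((convex hull D) \<times> {0} \<union> {0} \<times> ?K)"
    using polytope_imp_convex[OF K] by (intro direct_sum_eq_convex_hull) simp_all
  also have "(convex hull D) \<times> {0} = convex hull (D \<times> {0::'a})" by (simp add: convex_hull_Times)
  also have "convex hull (convex hull (D \<times> {0::'a}) \<union> {0} \<times> ?K) = convex hull (D \<times> {0} \<union> {0} \<times> ?K)"
    by (rule hull_Un_left[symmetric])
  finally have eq2: "direct_sum (convex hull D) ?K = convex hull (D \<times> {0} \<union> {0} \<times> ?K)" .
  have "int (card D - 1) simplex convex hull D"
    using V affine_independent_subset[OF V(1,2)] by (intro simplex_convex_hull) auto
  then show ?thesis
    unfolding pyr_simplex_sum_def using V(3) Q(2) pyr unfolding eq2[symmetric] by blast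
qed

section \<open>Special simplices and basis polytopes\<close>

text \<open>Translation by a point of \<open>S\<close> turns the fibre into the kernel, which is
  then the span of the translated \<open>S\<close>, inside the span of the translated
  \<open>P\<close>. Rank and nullity on the latter span give the difference.\<close>

lemma aff_dim_linear_image_kernel:
  fixes f :: "'a::euclidean_space \<Rightarrow> 'b::euclidean_space"
  assumes f: "linear f" and "S \<subseteq> P" "S \<noteq> {}" and S: "affine hull S = {x. f x = q}"
  shows "aff_dim (f ` P) = aff_dim P - aff_dim S"
proof -
  obtain s where s: "s \<in> S" using assms(3) by blast
  let ?t = "(+) (- s)" and ?N = "{x. f x = 0}"
  have fs: "f s = q" using S hull_inc[OF s] by blast
  have "?N = ?t ` {x. f x = q}"
  proof (intro set_eqI iffI)
    fix x assume "x \<in> ?N"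
    then have "f (s + x) = q" by (simp add: linear_add[OF f] fs)
    then show "x \<in> ?t ` {x. f x = q}" by (intro image_eqI[of _ _ "s + x"]) simp_all
  next
    fix x assume "x \<in> ?t ` {x. f x = q}"
    then obtain y where "f y = q" "x = - s + y" by blast
    then show "x \<in> ?N" using linear_diff[OF f, of y s] fs by simp
  qed
  also have "\<dots> = affine hull (?t ` S)" by (simp only: affine_hull_translation S)
  finally have N: "?N = affine hull (?t ` S)" .
  have 0: "0 \<in> ?t ` S" "0 \<in> ?t ` P" using s assms(2) by force+
  have N': "?N = span (?t ` S)" unfolding N using 0(1) by (simp add: affine_hull_span_0 hull_inc)
  have "aff_dim S = aff_dim (?t ` S)" by (rule aff_dim_translation_eq[symmetric])
  also have "\<dots> = int (dim (?t ` S))" using 0(1) by (intro aff_dim_zero hull_inc)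
  also have "dim (?t ` S) = dim ?N" unfolding N' by (rule dim_span[symmetric])
  finally have dS: "aff_dim S = int (dim ?N)" .
  have "aff_dim P = aff_dim (?t ` P)" by (rule aff_dim_translation_eq[symmetric])
  also have "\<dots> = int (dim (?t ` P))" using 0(2) by (intro aff_dim_zero hull_inc)
  finally have dP: "aff_dim P = int (dim (span (?t ` P)))" by simp
  have "f ` ?t ` P = (+) (- q) ` f ` P"
    by (simp add: image_image linear_add[OF f] linear_neg[OF f] fs linear_diff[OF f])
  then have "aff_dim (f ` P) = aff_dim (f ` ?t ` P)" by (simp only: aff_dim_translation_eq)
  also have "\<dots> = int (dim (f ` ?t ` P))"
    using 0(2) linear_0[OF f] by (intro aff_dim_zero hull_inc) (metis imageI)
  also have "dim (f ` ?t ` P) = dim (f ` span (?t ` P))"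
    unfolding linear_span_image[OF f, symmetric] by (rule dim_span[symmetric])
  finally have dQ: "aff_dim (f ` P) = int (dim (f ` span (?t ` P)))" .
  have "?N \<subseteq> span (?t ` P)" unfolding N' using assms(2) by (intro span_mono image_mono)
  then have "span (?t ` P) \<inter> ?N = ?N" by (rule Int_absorb1)
  then have "dim (f ` span (?t ` P)) + dim ?N = dim (span (?t ` P))"
    using dim_image_add_dim_kernel[OF f subspace_span, of "?t ` P"] by simp
  then show ?thesis unfolding dS dP dQ by linarith
qed

lemma special_simplexD:
  assumes "special_simplex m S P"
  shows "\<not> affine_dependent (vertices S)" "finite (vertices S)" "card (vertices S) = Suc m"
    "S = convex hull (vertices S)" "vertices S \<subseteq> vertices P" "aff_dim S = int m"
    "\<And>F. F facet_of P \<Longrightarrow> card (vertices S \<inter> F) = m"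
proof -
  note s = assms[unfolded special_simplex_def]
  obtain C where C: "\<not> affine_dependent C" "int (card C) = int m + 1" "S = convex hull C"
    using s unfolding simplex_def by blast
  have V: "vertices S = C" unfolding C(3) by (rule vertices_convex_hull_affine_independent[OF C(1)])
  show "\<not> affine_dependent (vertices S)" "finite (vertices S)" "card (vertices S) = Suc m"
    "S = convex hull (vertices S)"
    unfolding V using C aff_independent_finite[OF C(1)] by auto
  show "vertices S \<subseteq> vertices P" "\<And>F. F facet_of P \<Longrightarrow> card (vertices S \<inter> F) = m"
    "aff_dim S = int m"
    using s aff_dim_simplex by blast+
qed

lemma special_simplex_subset:
  assumes "special_simplex m S P" "convex P"
  shows "S \<subseteq> P"
proof -
  have "vertices S \<subseteq> P"
    using special_simplexD(5)[OF assms(1)] by (auto simp: vertices_def extreme_point_of_def)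
  then have "convex hull (vertices S) \<subseteq> P" using assms(2) by (rule hull_minimal)
  then show ?thesis using special_simplexD(4)[OF assms(1)] by simp
qed

section \<open>Facets and functionals of a special simplex\<close>

lemma polytope_eq_convex_hull_vertices:
  "polytope P \<Longrightarrow> P = convex hull (vertices P)"
  unfolding vertices_def
  by (intro Krein_Milman_Minkowski polytope_imp_compact polytope_imp_convex)

text \<open>A nonempty proper face is the intersection of the facets containing it, so one of these
  misses \<open>x\<close>.\<close>

lemma facet_avoiding_vertex:
  assumes P: "polytope P" "1 \<le> aff_dim P" and x: "x \<in> vertices P" and G: "G face_of P" "x \<notin> G"
  obtains F where "F facet_of P" "G \<subseteq> F" "x \<notin> F"
proof -
  have xP: "x \<in> P" using x by (simp add: vertices_def extreme_point_of_def)
  \<comment> \<open>The empty face has to be enlarged before facets can be intersected; a second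
    vertex serves, which exists since \<open>P\<close> is not a point.\<close>
  have "\<exists>G'. G' face_of P \<and> G \<subseteq> G' \<and> x \<notin> G' \<and> G' \<noteq> {}"
  proof (cases "G = {}")
    case True
    have "\<not> vertices P \<subseteq> {x}"
    proof
      assume "vertices P \<subseteq> {x}"
      then have "vertices P = {x}" using x by blast
      then have "P = {x}" using polytope_eq_convex_hull_vertices[OF P(1)] by simp
      then show False using P(2) by simp
    qed
    then obtain y where "y \<in> vertices P" "y \<noteq> x" by blast
    then show ?thesis using True by (intro exI[of _ "{y}"]) (auto simp: vertices_def face_of_singleton)
  next
    case False
    then show ?thesis using G by blast
  qed
  then obtain G' where G': "G' face_of P" "G \<subseteq> G'" "x \<notin> G'" "G' \<noteq> {}" by blast
  have "G' \<noteq> P" using G'(3) xP by blast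
  from face_of_polyhedron[OF polytope_imp_polyhedron[OF P(1)] G'(1,4) this] G'(3)
  obtain F where "F facet_of P" "G' \<subseteq> F" "x \<notin> F" by blast
  then show thesis using that G'(2) by blast
qed

text \<open>A facet missing \<open>v\<close> still contains \<open>m\<close> of the
  \<open>m + 1\<close> vertices of \<open>S\<close>, hence all the others. Its supporting functional
  therefore singles out \<open>v\<close>.\<close>

lemma special_simplex_functional:
  assumes P: "polytope P" "1 \<le> aff_dim P" and S: "special_simplex m S P"
    and v: "v \<in> vertices S" and G: "G face_of P" "v \<notin> G"
  obtains a b where "P \<subseteq> {x. a \<bullet> x \<le> b}" "G \<subseteq> {x. a \<bullet> x = b}" "a \<bullet> v < b"
    "\<And>w. w \<in> vertices S \<Longrightarrow> w \<noteq> v \<Longrightarrow> a \<bullet> w = b"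
proof -
  note s = special_simplexD[OF S]
  have vP: "v \<in> vertices P" using v s(5) by blast
  obtain F where F: "F facet_of P" "G \<subseteq> F" "v \<notin> F"
    using facet_avoiding_vertex[OF P vP G] by blast
  obtain a b where ab: "P \<subseteq> {x. a \<bullet> x \<le> b}" "F = P \<inter> {x. a \<bullet> x = b}"
    using facet_of_polyhedron[OF polytope_imp_polyhedron[OF P(1)] F(1)] by metis
  have "vertices S \<inter> F = vertices S - {v}"
  proof (rule card_subset_eq)
    show "finite (vertices S - {v})" using s(2) by simp
    show "vertices S \<inter> F \<subseteq> vertices S - {v}" using F(3) by blast
    show "card (vertices S \<inter> F) = card (vertices S - {v})"
      using s(2,3) v s(7)[OF F(1)] by (simp add: card_Diff_singleton)
  qed
  then have *: "a \<bullet> w = b" if "w \<in> vertices S" "w \<noteq> v" for w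
    using that ab(2) by blast
  have "v \<in> P" using vP by (simp add: vertices_def extreme_point_of_def)
  then have "a \<bullet> v < b" using ab F(3) by (auto simp: less_le)
  moreover have "G \<subseteq> {x. a \<bullet> x = b}" using F(2) ab(2) by blast
  ultimately show thesis using that[OF ab(1) _ _ *] by blast
qed

lemma inner_sum_all_but_one:
  fixes V :: "'a::real_inner set"
  assumes "finite V" "v \<in> V" "\<And>w. w \<in> V \<Longrightarrow> w \<noteq> v \<Longrightarrow> a \<bullet> w = b"
  shows "a \<bullet> (\<Sum>w\<in>V. t w *\<^sub>R w) = b * sum t V - t v * (b - a \<bullet> v)"
proof -
  have "a \<bullet> (\<Sum>w\<in>V. t w *\<^sub>R w) = (\<Sum>w\<in>V. t w * (a \<bullet> w))" by (simp add: inner_sum_right)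
  also have "\<dots> = (\<Sum>w\<in>V. t w * b - (if w = v then t v * (b - a \<bullet> v) else 0))"
    using assms(3) by (intro sum.cong) (auto simp: algebra_simps)
  also have "\<dots> = b * sum t V - t v * (b - a \<bullet> v)"
    using assms(1,2) by (simp add: sum_subtractf sum_distrib_left mult.commute)
  finally show ?thesis .
qed

text \<open>For each vertex \<open>v\<close>, the bound on \<open>P\<close> of the functional that
  singles out \<open>v\<close> forces the affine coordinate of \<open>z\<close> at \<open>v\<close>
  to be nonnegative.\<close>

lemma special_simplex_Int_affine_hull:
  assumes P: "polytope P" "1 \<le> aff_dim P" and S: "special_simplex m S P"
    and z: "z \<in> P" "z \<in> affine hull S"
  shows "z \<in> S"
proof -
  note s = special_simplexD[OF S]
  let ?V = "vertices S"
  have "affine hull S = affine hull ?V" by (subst s(4)) (rule affine_hull_convex_hull)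
  then have "z \<in> affine hull ?V" using z(2) by simp
  then have "\<exists>t. sum t ?V = 1 \<and> (\<Sum>w\<in>?V. t w *\<^sub>R w) = z"
    unfolding affine_hull_finite[OF s(2)] mem_Collect_eq .
  then obtain t where t: "sum t ?V = 1" "(\<Sum>w\<in>?V. t w *\<^sub>R w) = z" by (elim exE conjE)
  have "0 \<le> t v" if v: "v \<in> ?V" for v
  proof -
    obtain a b where ab: "P \<subseteq> {x. a \<bullet> x \<le> b}" "a \<bullet> v < b" "\<And>w. w \<in> ?V \<Longrightarrow> w \<noteq> v \<Longrightarrow> a \<bullet> w = b"
    proof (rule special_simplex_functional[OF P S v empty_face_of])
      show "v \<notin> {}" by simp
    qed (rule that)
    have "a \<bullet> z = b * sum t ?V - t v * (b - a \<bullet> v)"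
      unfolding t(2)[symmetric] by (rule inner_sum_all_but_one[OF s(2) v ab(3)])
    moreover have "a \<bullet> z \<le> b" using ab(1) z(1) by blast
    ultimately have "0 \<le> t v * (b - a \<bullet> v)" using t(1) by simp
    then show ?thesis using ab(2) by (simp add: zero_le_mult_iff)
  qed
  then have "z \<in> convex hull ?V" unfolding convex_hull_finite[OF s(2)] using t by blast
  then show ?thesis by (subst s(4))
qed

text \<open>A face without vertices of the simplex lies, for each vertex \<open>v\<close> of the simplex, in a facet
  missing only \<open>v\<close>; this forces each coefficient of \<open>z - y\<close> to be nonnegative.\<close>

lemma special_simplex_avoiding_face:
  assumes P: "polytope P" "1 \<le> aff_dim P" and S: "special_simplex m S P"
    and G: "G face_of P" "vertices S \<inter> G = {}" and yz: "y \<in> G" "z \<in> P"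
    and t: "z - y = (\<Sum>w\<in>vertices S. t w *\<^sub>R w)" "sum t (vertices S) = 0"
  shows "z = y"
proof -
  note s = special_simplexD[OF S]
  let ?V = "vertices S"
  have nonneg: "0 \<le> t v" if v: "v \<in> ?V" for v
  proof -
    have "v \<notin> G" using v G(2) by blast
    then obtain a b where ab: "P \<subseteq> {x. a \<bullet> x \<le> b}" "G \<subseteq> {x. a \<bullet> x = b}" "a \<bullet> v < b"
      "\<And>w. w \<in> ?V \<Longrightarrow> w \<noteq> v \<Longrightarrow> a \<bullet> w = b"
      by (rule special_simplex_functional[OF P S v G(1)]) (rule that)
    have "a \<bullet> (z - y) = b * sum t ?V - t v * (b - a \<bullet> v)"
      unfolding t(1) by (rule inner_sum_all_but_one[OF s(2) v ab(4)])
    moreover have "a \<bullet> z \<le> b" "a \<bullet> y = b" using ab(1,2) yz by blast+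
    ultimately have "0 \<le> t v * (b - a \<bullet> v)" using t(2) by (simp add: inner_diff_right)
    then show ?thesis using ab(3) by (simp add: zero_le_mult_iff)
  qed
  then have "\<forall>v\<in>?V. t v = 0" using t(2) by (subst (asm) sum_nonneg_eq_0_iff[OF s(2)]) auto
  then have "z - y = 0" unfolding t(1) by simp
  then show ?thesis by simp
qed

text \<open>A facet through a relative interior point of \<open>S\<close> would contain all
  \<open>m + 1\<close> vertices of \<open>S\<close>, one more than allowed; so such a point lies on
  no facet.\<close>

lemma special_simplex_rel_interior:
  assumes P: "polytope P" and S: "special_simplex m S P"
  shows "rel_interior S \<subseteq> rel_interior P"
proof
  fix c assume c: "c \<in> rel_interior S"
  note s = special_simplexD[OF S]
  have sub: "S \<subseteq> P" using S polytope_imp_convex[OF P] by (rule special_simplex_subset)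
  have "c \<notin> F" if F: "F facet_of P" for F
  proof
    assume "c \<in> F"
    then have "S \<subseteq> F"
      using c by (intro subset_of_face_of[OF facet_of_imp_face_of[OF F] sub]) blast
    then have "vertices S \<subseteq> F" by (auto simp: vertices_def extreme_point_of_def)
    then have "vertices S \<inter> F = vertices S" by blast
    then show False using s(3) s(7)[OF F] by simp
  qed
  moreover have "c \<in> P" using c sub rel_interior_subset by blast
  ultimately show "c \<in> rel_interior P"
    unfolding rel_interior_of_polyhedron[OF polytope_imp_polyhedron[OF P]] by blast
qed

section \<open>Basis polytope and basis space of a special simplex\<close>

text \<open>A translate of the kernel is a fibre of \<open>f\<close>; \<open>q\<close> is the point
  to which the affine hull of the simplex is collapsed.\<close>

lemma basis_polytopeE:
  assumes "basis_polytope P S Q" "S \<noteq> {}"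
  obtains f q where "linear f" "Q = f ` P" "affine hull S = {x. f x = q}"
proof -
  obtain f a where f: "linear f" "affine hull S = (+) a ` {x. f x = 0}" "Q = f ` P"
    using assms(1) unfolding basis_polytope_def affine_parallel_def by blast
  have "(+) a ` {x. f x = 0} = {x. f x = f a}"
  proof (intro set_eqI iffI)
    fix x assume "x \<in> {x. f x = f a}"
    then have "f (x - a) = 0" by (simp add: linear_diff[OF f(1)])
    then show "x \<in> (+) a ` {x. f x = 0}" by (intro image_eqI[of _ _ "x - a"]) simp_all
  qed (auto simp: linear_add[OF f(1)])
  then show thesis using that[OF f(1,3), of "f a"] f(2) by simp
qed

lemma basis_polytope_dim_rel_interior:
  assumes P: "polytope P" and S: "special_simplex m S P"
    and f: "linear f" "affine hull S = {x. f x = q}"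
  shows "aff_dim (f ` P) = aff_dim P - int m" "q \<in> rel_interior (f ` P)" "\<And>x. x \<in> S \<Longrightarrow> f x = q"
proof -
  note s = special_simplexD[OF S]
  have sub: "S \<subseteq> P" using S polytope_imp_convex[OF P] by (rule special_simplex_subset)
  have ne: "S \<noteq> {}" using s(6) by auto
  show "aff_dim (f ` P) = aff_dim P - int m"
    using aff_dim_linear_image_kernel[OF f(1) sub ne f(2)] s(6) by simp
  show S: "f x = q" if "x \<in> S" for x using f(2) hull_inc[OF that] by blast
  have "convex S" using s(4) convex_convex_hull by metis
  then obtain c where c: "c \<in> rel_interior S" using ne rel_interior_eq_empty by blast
  then have "f c \<in> rel_interior (f ` P)"
    using special_simplex_rel_interior[OF P assms(2)]
      rel_interior_convex_linear_image[OF f(1) polytope_imp_convex[OF P]] by blast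
  moreover have "f c = q" using c S rel_interior_subset by blast
  ultimately show "q \<in> rel_interior (f ` P)" by simp
qed

text \<open>A face avoiding \<open>S\<close> is the hull of its own vertices, which are vertices of
  \<open>P\<close> outside \<open>S\<close>; conversely each of those vertices is such a
  face.\<close>

lemma basis_space_eq:
  assumes P: "polytope P" and S: "special_simplex m S P"
  shows "basis_space P S = affine hull (vertices P - vertices S)"
proof -
  let ?U = "\<Union>{F. F face_of P \<and> vertices S \<inter> F = {}}" and ?W = "vertices P - vertices S"
  have "?U \<subseteq> affine hull ?W"
  proof
    fix x assume "x \<in> ?U"
    then obtain F where F: "F face_of P" "vertices S \<inter> F = {}" "x \<in> F" by blast
    have "vertices F \<subseteq> ?W"
      using F(2) extreme_point_of_face[OF F(1)] by (auto simp: vertices_def)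
    moreover have "F = convex hull (vertices F)"
      using face_of_polytope_polytope[OF P F(1)] by (rule polytope_eq_convex_hull_vertices)
    ultimately have "F \<subseteq> convex hull ?W" using hull_mono by metis
    then show "x \<in> affine hull ?W" using F(3) convex_hull_subset_affine_hull by blast
  qed
  moreover have "?W \<subseteq> ?U"
    by (force simp: vertices_def face_of_singleton[symmetric])
  ultimately show ?thesis
    unfolding basis_space_def
    by (intro antisym hull_minimal hull_mono affine_affine_hull)
qed

text \<open>\<open>K\<close> is the hull of the vertices outside \<open>S\<close>, or one point if
  \<open>P\<close> is the simplex. Collapsing \<open>S\<close> to the interior point
  \<open>q\<close> produces no vertex of the basis polytope, so \<open>K\<close> covers it; meekness
  makes the dimensions agree, whence injectivity. The common point \<open>c\<close> is a preimage of
  \<open>q\<close> in \<open>K\<close>.\<close>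

lemma special_meek_decomposition:
  fixes P :: "'a::euclidean_space set" and f :: "'a \<Rightarrow> 'b::euclidean_space"
  assumes P: "polytope P" "1 \<le> aff_dim P" and m: "1 \<le> m"
    and S: "special_simplex m S P" and meek: "meek P S"
    and f: "linear f" "affine hull S = {x. f x = q}"
  obtains c K where "c \<in> K" "c \<in> S" "c \<notin> vertices S" "P = convex hull (vertices S \<union> K)"
    "f ` K = f ` P" "inj_on f (span ((+) (- c) ` K))"
proof -
  note s = special_simplexD[OF S] and b = basis_polytope_dim_rel_interior[OF P(1) S f]
  let ?V = "vertices S" and ?W = "vertices P - vertices S"
  have sub: "S \<subseteq> P" using S polytope_imp_convex[OF P(1)] by (rule special_simplex_subset)
  have ne: "S \<noteq> {}" using s(6) by auto
  have cS: "convex S" by (subst s(4)) (rule convex_convex_hull)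
  have V_ext: "v extreme_point_of S" if "v \<in> ?V" for v using that by (simp add: vertices_def)
  have PV: "P = convex hull (?V \<union> ?W)"
  proof -
    have "?V \<union> ?W = vertices P" using s(5) by blast
    then show ?thesis using polytope_eq_convex_hull_vertices[OF P(1)] by simp
  qed
  obtain Q0 :: "'a set" where Q0: "basis_polytope P S Q0" "aff_dim Q0 = max 0 (aff_dim (basis_space P S))"
    using meek unfolding meek_def by blast
  have dim: "aff_dim P - int m = max 0 (aff_dim ?W)"
  proof -
    obtain g q' where g: "linear g" "Q0 = g ` P" "affine hull S = {x. g x = q'}"
      by (rule basis_polytopeE[OF Q0(1) ne]) (rule that)
    have "aff_dim Q0 = aff_dim P - int m"
      unfolding g(2) by (rule basis_polytope_dim_rel_interior(1)[OF P(1) S g(1,3)])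
    then show ?thesis using Q0(2) basis_space_eq[OF P(1) S] by simp
  qed
  show thesis
  proof (cases "aff_dim P = int m")
    \<comment> \<open>This is \<open>n = m\<close>: the affine hulls agree and \<open>P\<close> is
      the simplex. A relative interior point serves as \<open>K\<close>; it is not a vertex because
      \<open>m\<close> is positive.\<close>
    case True
    have "affine hull S = affine hull P"
      using sub s(6) True by (intro aff_dim_eq_full_gen[THEN iffD1] antisym) simp_all
    then have "P \<subseteq> affine hull S" using hull_subset by metis
    then have PS: "P = S" using special_simplex_Int_affine_hull[OF P S] sub by blast
    obtain c where c: "c \<in> rel_interior S" using cS ne rel_interior_eq_empty by blast
    have cS': "c \<in> S" using c rel_interior_subset by blast
    have "S \<noteq> {c}" using s(6) m by auto
    then have "c \<notin> ?V" using c V_ext extreme_point_not_in_REL_INTERIOR by blast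
    moreover have "P = convex hull (?V \<union> {c})"
      using hull_redundant[of c convex ?V] cS' s(4) PS by simp
    moreover have "f ` {c} = f ` P"
      unfolding PS using b(3) cS' by auto
    ultimately show thesis using that[of c "{c}"] cS' by simp
  next
    case False
    let ?K = "convex hull ?W"
    \<comment> \<open>The codimension is nonzero here, so the maximum in the meekness condition is
      the actual dimension, and it is positive.\<close>
    have W: "aff_dim ?W = aff_dim P - int m" "1 \<le> aff_dim ?W" using dim False by linarith+
    have "f ` ?V \<subseteq> {q}" using b(3) V_ext by (auto simp: extreme_point_of_def)
    then have "f ` (?V \<union> ?W) \<subseteq> insert q (f ` ?W)" by blast
    then have "f ` P \<subseteq> convex hull (insert q (f ` ?W))"
      unfolding PV[THEN arg_cong[where f = "(`) f"]] convex_hull_linear_image[OF f(1)] by (rule hull_mono)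
    moreover have "q \<in> f ` P" using b(2) rel_interior_subset by blast
    then have "insert q (f ` ?W) \<subseteq> f ` P" by (auto simp: vertices_def extreme_point_of_def)
    then have "convex hull (insert q (f ` ?W)) \<subseteq> f ` P"
      using f(1) polytope_imp_convex[OF P(1)] by (intro hull_minimal convex_linear_image)
    ultimately have Q: "f ` P = convex hull (insert q (f ` ?W))" by (rule antisym)
    have "f ` P \<noteq> {q}" using b(1) W by auto
    \<comment> \<open>\<open>q\<close> is relatively interior to a polytope that is not a point, so
      it is no vertex; all vertices of the basis polytope come from vertices of \<open>P\<close>
      outside \<open>S\<close>.\<close>
    then have "\<not> q extreme_point_of f ` P"
      using b(2) extreme_point_not_in_REL_INTERIOR by blast
    then have "vertices (f ` P) \<subseteq> f ` ?W"
      using extreme_point_of_convex_hull[of _ "insert q (f ` ?W)"] unfolding Q[symmetric]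
      by (auto simp: vertices_def)
    then have "convex hull (vertices (f ` P)) \<subseteq> convex hull (f ` ?W)" by (rule hull_mono)
    then have "f ` P \<subseteq> f ` ?K"
      using polytope_eq_convex_hull_vertices[OF polytope_linear_image[OF f(1) P(1)]]
      by (simp add: convex_hull_linear_image[OF f(1)])
    moreover have KP: "?K \<subseteq> P" by (subst PV) (rule hull_mono, blast)
    ultimately have fK: "f ` ?K = f ` P" by blast
    obtain c where c: "c \<in> ?K" "f c = q" using \<open>q \<in> f ` P\<close> unfolding fK[symmetric] by blast
    have "c \<in> affine hull S" using c(2) f(2) by simp
    then have cS': "c \<in> S" using special_simplex_Int_affine_hull[OF P S] c(1) KP by blast
    \<comment> \<open>A vertex of \<open>P\<close> that lies in \<open>K\<close> is extreme in
      \<open>K\<close>, hence one of the vertices outside \<open>S\<close> that generate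
      \<open>K\<close>.\<close>
    have "c \<notin> ?V"
    proof
      assume c': "c \<in> ?V"
      then have "c extreme_point_of P" using s(5) by (auto simp: vertices_def)
      then have "c extreme_point_of ?K" using c(1) KP by (auto simp: extreme_point_of_def)
      then have "c \<in> ?W" by (rule extreme_point_of_convex_hull)
      then show False using c' by blast
    qed
    moreover have "P = convex hull (?V \<union> ?K)"
      by (subst PV) (rule hull_Un_right)
    \<comment> \<open>Equal dimensions before and after mapping leave no kernel in the span.\<close>
    moreover have "inj_on f (span ((+) (- c) ` ?K))"
    proof -
      let ?T = "(+) (- c) ` ?K"
      have 0: "0 \<in> ?T" using c(1) by force
      have "f ` ?T = (+) (- f c) ` f ` ?K"
        by (simp add: image_image linear_diff[OF f(1)])
      then have "aff_dim (f ` ?T) = aff_dim (f ` P)" unfolding fK by (simp only: aff_dim_translation_eq)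
      moreover have "aff_dim (f ` ?T) = int (dim (f ` ?T))"
        using 0 linear_0[OF f(1)] by (intro aff_dim_zero hull_inc) (metis imageI)
      moreover have "aff_dim ?T = aff_dim ?W" by (simp only: aff_dim_translation_eq aff_dim_convex_hull)
      moreover have "aff_dim ?T = int (dim ?T)" using 0 by (intro aff_dim_zero hull_inc)
      ultimately have "dim (f ` ?T) = dim ?T" using W b(1) by linarith
      moreover have "dim (f ` ?T) = dim (f ` span ?T)"
        unfolding linear_span_image[OF f(1), symmetric] by (rule dim_span[symmetric])
      moreover have "dim (f ` span ?T) + dim (span ?T \<inter> {x. f x = 0}) = dim (span ?T)"
        by (rule dim_image_add_dim_kernel[OF f(1) subspace_span])
      ultimately have "dim (span ?T \<inter> {x. f x = 0}) = 0" by simp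
      then have "span ?T \<inter> {x. f x = 0} \<subseteq> {0}" by (simp only: dim_eq_0)
      then show ?thesis unfolding linear_inj_on_iff_eq_0[OF f(1) subspace_span] by blast
    qed
    ultimately show thesis using that[of c ?K] c(1) cS' fK by blast
  qed
qed

text \<open>\<open>D\<close> collects the points with positive barycentric coordinate; were it a
  single point, \<open>c\<close> would be that point of \<open>V\<close>.\<close>

lemma convex_hull_support:
  fixes V :: "'a::euclidean_space set"
  assumes V: "\<not> affine_dependent V" and c: "c \<in> convex hull V" "c \<notin> V"
  obtains D where "D \<subseteq> V" "c \<in> rel_interior (convex hull D)" "2 \<le> card D"
proof -
  have fin: "finite V" using V by (rule aff_independent_finite)
  obtain u where u: "\<forall>v\<in>V. 0 \<le> u v" "sum u V = 1" "(\<Sum>v\<in>V. u v *\<^sub>R v) = c"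
    using c(1) unfolding convex_hull_finite[OF fin] by blast
  define D where "D = {v \<in> V. 0 < u v}"
  have D: "D \<subseteq> V" unfolding D_def by (rule Collect_restrict)
  have z: "u v = 0" if "v \<in> V - D" for v using u(1) that by (force simp: D_def)
  have "sum u D = sum u V" using fin D z by (intro sum.mono_neutral_left) auto
  moreover have "(\<Sum>v\<in>D. u v *\<^sub>R v) = (\<Sum>v\<in>V. u v *\<^sub>R v)"
    using fin D z by (intro sum.mono_neutral_left) auto
  ultimately have uD: "sum u D = 1" "(\<Sum>v\<in>D. u v *\<^sub>R v) = c" using u by simp_all
  have "c \<in> rel_interior (convex hull D)"
    unfolding rel_interior_convex_hull_explicit[OF affine_independent_subset[OF V D]] mem_Collect_eq
    using uD by (intro exI[of _ u]) (simp add: D_def)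
  moreover have "2 \<le> card D"
  proof (rule ccontr)
    assume "\<not> 2 \<le> card D"
    moreover have "D \<noteq> {}" using uD(1) by auto
    then have "card D \<noteq> 0" using finite_subset[OF D fin] by simp
    ultimately have "card D = 1" by linarith
    then obtain d where "D = {d}" by (rule card_1_singletonE)
    then have "c = d" using uD by simp
    then show False using c(2) D \<open>D = {d}\<close> by blast
  qed
  ultimately show thesis using that D by blast
qed

section \<open>The pyramid form of a meek polytope\<close>

text \<open>The simplex and \<open>Q\<close> are translated by different vectors, in separate
  factors of a product, so that both interior points become the origin. The result is the model to
  which \<open>P\<close> is compared.\<close>

lemma translated_wedge_product:
  fixes V Q :: "'a::euclidean_space set"
  assumes V: "\<not> affine_dependent V" and D: "D \<subseteq> V" "c \<in> rel_interior (convex hull D)" "2 \<le> card D"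
    and Q: "polytope Q" "q \<in> rel_interior Q"
  shows "wedge ((+) (- c) ` D \<times> {0}) ((+) (- c) ` V \<times> {0}) ({0} \<times> (+) (- q) ` Q)"
    "pyr_simplex_sum (card (V - D)) (card D - 1) Q
       (convex hull ((+) (- c) ` V \<times> {0} \<union> {0} \<times> (+) (- q) ` Q))"
proof -
  let ?t = "(+) (- c)" and ?Q = "(+) (- q) ` Q"
  have card_t: "card (?t ` A) = card A" for A :: "'a set" by (simp add: card_image)
  have V': "\<not> affine_dependent (?t ` V)" using V affine_dependent_translation_eq by metis
  have D': "0 \<in> rel_interior (convex hull (?t ` D))"
    unfolding convex_hull_translation rel_interior_translation using D(2) by (simp only: image_iff) force
  have card: "2 \<le> card (?t ` D)" unfolding card_t by (rule D(3))
  have Q0: "0 \<in> rel_interior ?Q"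
    unfolding rel_interior_translation using Q(2) by (simp only: image_iff) force
  have "polytope ?Q" using Q(1) by (simp only: polytope_translation_eq)
  then show "wedge (?t ` D \<times> {0}) (?t ` V \<times> {0}) ({0} \<times> ?Q)"
    by (intro wedge_product V' image_mono[OF D(1)] D' card Q0)
  have "?t ` V - ?t ` D = ?t ` (V - D)" by (rule image_set_diff[symmetric]) simp
  then have *: "card (?t ` V - ?t ` D) = card (V - D)" by (simp only: card_t)
  show "pyr_simplex_sum (card (V - D)) (card D - 1) Q (convex hull (?t ` V \<times> {0} \<union> {0} \<times> ?Q))"
    using wedge_product_pyr_simplex_sum[OF V' image_mono[OF D(1)] D' card Q(1) Q0]
    unfolding * unfolding card_t .
qed

lemma special_meek_imp_pyr_simplex_sum:
  fixes P Q :: "'a::euclidean_space set"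
  assumes P: "polytope P" "1 \<le> aff_dim P" and m: "1 \<le> m"
    and S: "special_simplex m S P" and meek: "meek P S" and Q: "basis_polytope P S Q"
  shows "\<exists>i j R. 0 < j \<and> i + j = m \<and> pyr_simplex_sum i j Q R \<and> P \<cong>\<^sub>F R"
proof -
  note s = special_simplexD[OF S]
  let ?V = "vertices S"
  have ne: "S \<noteq> {}" using s(6) by auto
  obtain f q where f: "linear f" "Q = f ` P" "affine hull S = {x. f x = q}"
    by (rule basis_polytopeE[OF Q ne]) (rule that)
  note b = basis_polytope_dim_rel_interior[OF P(1) S f(1,3)]
  obtain c K where c: "c \<in> K" "c \<in> S" "c \<notin> ?V" and PK: "P = convex hull (?V \<union> K)"
    and fK: "f ` K = f ` P" and inj: "inj_on f (span ((+) (- c) ` K))"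
    by (rule special_meek_decomposition[OF P m S meek f(1,3)]) (rule that)
  have cV: "c \<in> convex hull ?V" by (subst s(4)[symmetric]) (rule c(2))
  obtain D where D: "D \<subseteq> ?V" "c \<in> rel_interior (convex hull D)" "2 \<le> card D"
    by (rule convex_hull_support[OF s(1) cV c(3)]) (rule that)
  let ?t = "(+) (- c)"
  have fc: "f c = q" using b(3) c(2) .
  have Qp: "polytope Q" unfolding f(2) by (rule polytope_linear_image[OF f(1) P(1)])
  let ?Q = "(+) (- q) ` Q"
  let ?R = "convex hull (?t ` ?V \<times> {0} \<union> {0} \<times> ?Q)"
  have "q \<in> rel_interior Q" unfolding f(2) by (rule b(2))
  then have pyr: "pyr_simplex_sum (card (?V - D)) (card D - 1) Q ?R"
    by (rule translated_wedge_product(2)[OF s(1) D Qp])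
  have "card (?V - D) + card D = Suc m"
    using D(1) s(2,3) finite_subset[OF D(1) s(2)] card_mono[OF s(2) D(1)] by (simp add: card_Diff_subset)
  \<comment> \<open>The apices are the vertices outside \<open>D\<close>; the simplex on
    \<open>D\<close> has dimension \<open>card D - 1\<close>, which is positive as \<open>D\<close>
    has two points.\<close>
  then have ij: "0 < card D - 1" "card (?V - D) + (card D - 1) = m" using D(3) by linarith+
  let ?U = "span (?t ` K)"
  obtain g where g: "linear g" "\<forall>u\<in>?U. g (f u) = u"
    using linear_exists_left_inverse_on[OF f(1) subspace_span inj] by blast
  \<comment> \<open>\<open>g\<close> lifts the translated basis polytope back to the translated
    \<open>K\<close>, so adding the two factors of the model reproduces \<open>P\<close> up to
    translation.\<close>
  define \<psi> where "\<psi> = (\<lambda>z::'a \<times> 'a. fst z + g (snd z))"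
  have \<psi>: "linear \<psi>"
    unfolding \<psi>_def using linear_compose[OF linear_snd g(1)]
    by (intro linear_compose_add linear_fst) (simp add: comp_def)
  have Q': "?Q = f ` ?t ` K"
    unfolding f(2) fK[symmetric] by (simp add: image_image linear_diff[OF f(1)] fc)
  have "g (f x) = x" if "x \<in> ?t ` K" for x using g(2) span_base[OF that] by blast
  then have "g ` ?Q = ?t ` K" unfolding Q' image_image[of g f] by simp
  moreover have "\<psi> ` (A \<times> {0}) = A" for A
  proof -
    have "\<psi> ` (\<lambda>x. (x, 0)) ` A = A" by (simp add: image_image \<psi>_def linear_0[OF g(1)])
    moreover have "A \<times> {0} = (\<lambda>x. (x, 0::'a)) ` A" by blast
    ultimately show ?thesis by simp
  qed
  moreover have "\<psi> ` ({0} \<times> B) = g ` B" for B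
  proof -
    have "\<psi> ` Pair 0 ` B = g ` B" by (simp add: image_image \<psi>_def)
    moreover have "{0::'a} \<times> B = Pair 0 ` B" by blast
    ultimately show ?thesis by simp
  qed
  ultimately have "\<psi> ` (?t ` ?V \<times> {0} \<union> {0} \<times> ?Q) = ?t ` ?V \<union> ?t ` K"
    by (simp only: image_Un)
  then have "\<psi> ` ?R = convex hull (?t ` (?V \<union> K))"
    unfolding convex_hull_linear_image[OF \<psi>] by (simp only: image_Un)
  also have "\<dots> = ?t ` (convex hull (?V \<union> K))" by (rule convex_hull_translation)
  finally have im: "\<psi> ` ?R = ?t ` P" unfolding PK[symmetric] .
  have k0: "f x = 0" if "x \<in> ?t ` ?V" for x
  proof -
    obtain v where v: "v \<in> ?V" "x = - c + v" using \<open>x \<in> ?t ` ?V\<close> by blast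
    have "f v = q" using b(3) v(1) by (auto simp: vertices_def extreme_point_of_def)
    then show ?thesis using v(2) fc linear_diff[OF f(1), of v c] by simp
  qed
  \<comment> \<open>On this subspace the components can be recovered from their sum: applying
    \<open>f\<close> kills the first and returns the second. The model lies in it, so
    \<open>\<psi>\<close> is injective on the model.\<close>
  let ?Z = "{x. f x = 0} \<times> f ` ?U"
  have sZ: "subspace ?Z"
    by (intro subspace_Times linear_subspace_kernel linear_subspace_image f(1) subspace_span)
  have "?t ` ?V \<times> {0} \<union> {0} \<times> ?Q \<subseteq> ?Z"
  proof (rule Un_least)
    have "0 \<in> f ` ?U" using linear_subspace_image[OF f(1) subspace_span] by (rule subspace_0)
    then show "?t ` ?V \<times> {0} \<subseteq> ?Z" by (intro Sigma_mono subsetI CollectI k0) simp_all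
    have "f ` ?t ` K \<subseteq> f ` ?U" by (rule image_mono) (rule span_superset)
    then show "{0} \<times> ?Q \<subseteq> ?Z"
      unfolding Q' using linear_0[OF f(1)] by (intro Sigma_mono) simp_all
  qed
  then have RZ: "?R \<subseteq> ?Z" by (rule hull_minimal) (rule subspace_imp_convex[OF sZ])
  have "inj_on \<psi> ?Z"
    unfolding linear_inj_on_iff_eq_0[OF \<psi> sZ]
  proof (intro ballI impI)
    fix z assume z: "z \<in> ?Z" "\<psi> z = 0"
    then obtain u where u: "u \<in> ?U" "snd z = f u" "f (fst z) = 0" by auto
    have "fst z + u = 0" using z(2) g(2) u by (simp add: \<psi>_def)
    then have "f (fst z) + f u = 0" using linear_add[OF f(1), of "fst z" u] linear_0[OF f(1)] by simp
    then have fu: "f u = 0" using u(3) by simp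
    then have "u = 0" using g(2) u(1) linear_0[OF g(1)] by metis
    then show "z = 0" using \<open>fst z + u = 0\<close> u(2) fu by (simp add: prod_eq_iff)
  qed
  then have "inj_on \<psi> ?R" using RZ by (rule inj_on_subset)
  then have "?R \<cong>\<^sub>F \<psi> ` ?R" by (rule face_lattice_iso_linear_image[OF \<psi> convex_convex_hull])
  then have "?R \<cong>\<^sub>F ?t ` P" unfolding im .
  then have "P \<cong>\<^sub>F ?R"
    using face_lattice_iso_trans[OF face_lattice_iso_translation face_lattice_iso_sym] by blast
  then show ?thesis using ij pyr by blast
qed

section \<open>Combinatorial equivalence\<close>

text \<open>Adding \<open>u\<close> to a vertex stays in the affine hull of the simplex; subtracting
  the vertex again turns coefficients of sum \<open>1\<close> into coefficients of sum
  \<open>0\<close>.\<close>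

lemma linear_kernel_coefficients:
  assumes S: "special_simplex m S P" and f: "linear f" "affine hull S = {x. f x = q}" and u: "f u = 0"
  shows "\<exists>t. u = (\<Sum>w\<in>vertices S. t w *\<^sub>R w) \<and> sum t (vertices S) = 0"
proof -
  note s = special_simplexD[OF S]
  let ?V = "vertices S"
  have aff: "affine hull S = affine hull ?V" by (subst s(4)) (rule affine_hull_convex_hull)
  have "?V \<noteq> {}" using s(3) by auto
  then obtain v where v: "v \<in> ?V" by blast
  have "v \<in> affine hull S" unfolding aff using v by (rule hull_inc)
  then have "f v = q" unfolding f(2) by (rule CollectD)
  then have "u + v \<in> affine hull ?V" unfolding aff[symmetric] f(2) by (simp add: linear_add[OF f(1)] u)
  then have "\<exists>t. sum t ?V = 1 \<and> (\<Sum>w\<in>?V. t w *\<^sub>R w) = u + v"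
    unfolding affine_hull_finite[OF s(2)] mem_Collect_eq .
  then obtain t where t: "sum t ?V = 1" "(\<Sum>w\<in>?V. t w *\<^sub>R w) = u + v" by (elim exE conjE)
  let ?t = "\<lambda>w. t w - (if w = v then 1 else 0)"
  have "(\<Sum>w\<in>?V. (if w = v then 1 else 0) *\<^sub>R w) = (\<Sum>w\<in>?V. if w = v then w else 0)"
    by (rule sum.cong) auto
  also have "\<dots> = v" using s(2) v by simp
  finally have "(\<Sum>w\<in>?V. ?t w *\<^sub>R w) = u"
    by (simp only: scaleR_diff_left sum_subtractf t(2)) simp
  moreover have "sum ?t ?V = 0" using s(2) v t(1) by (simp add: sum_subtractf)
  ultimately show ?thesis by (intro exI[of _ ?t]) simp
qed

text \<open>Over the image of an avoiding face, \<open>P\<close> has just one point in each fibre,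
  so the face maps to a face and is the full preimage of its image. Conversely, a proper face of the
  basis polytope misses the interior point \<open>q\<close>, so its preimage avoids the simplex. The
  top elements are matched separately.\<close>

lemma basis_polytope_faces_iso:
  fixes P :: "'a::euclidean_space set" and f :: "'a \<Rightarrow> 'b::euclidean_space"
  assumes P: "polytope P" "1 \<le> aff_dim P" and S: "special_simplex m S P"
    and f: "linear f" "affine hull S = {x. f x = q}"
  shows "order_iso_on {G. G face_of f ` P} ({F. F face_of P \<and> vertices S \<inter> F = {}} \<union> {P})"
proof -
  let ?V = "vertices S"
  note s = special_simplexD[OF S] and b = basis_polytope_dim_rel_interior[OF P(1) S f]
  have conv: "convex P" using P(1) by (rule polytope_imp_convex)
  have inj: "z = y" if "F face_of P" "?V \<inter> F = {}" "y \<in> F" "z \<in> P" "f z = f y" for F y z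
  proof -
    have "f (z - y) = 0" using that(5) by (simp add: linear_diff[OF f(1)])
    then obtain t where t: "z - y = (\<Sum>w\<in>?V. t w *\<^sub>R w)" "sum t ?V = 0"
      using linear_kernel_coefficients[OF S f] by blast
    show ?thesis by (rule special_simplex_avoiding_face[OF P S that(1-4) t])
  qed
  have face: "f ` F face_of f ` P" if F: "F face_of P" "?V \<inter> F = {}" for F
    unfolding face_of_def
  proof (intro conjI ballI impI)
    show "f ` F \<subseteq> f ` P" using face_of_imp_subset[OF F(1)] by (rule image_mono)
    show "convex (f ` F)" using f(1) face_of_imp_convex[OF F(1)] by (rule convex_linear_image)
    fix a' b' x' assume "a' \<in> f ` P" "b' \<in> f ` P" "x' \<in> f ` F" and seg: "x' \<in> open_segment a' b'"
    then obtain a b x where abx: "a \<in> P" "b \<in> P" "x \<in> F" "a' = f a" "b' = f b" "x' = f x" by blast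
    have "f a \<noteq> f b" using seg abx by (auto simp: open_segment_def)
    then obtain z where z: "z \<in> open_segment a b" "f z = f x"
      using seg open_segment_linear_image[OF f(1)] abx by (metis imageE)
    have "z \<in> P" using conv z abx by (meson convex_contains_segment in_mono open_closed_segment)
    then have "z = x" by (rule inj[OF F abx(3) _ z(2)])
    then show "a' \<in> f ` F" "b' \<in> f ` F" using face_ofD[OF F(1)] z abx by blast+
  qed
  have vim: "P \<inter> f -` f ` F = F" if F: "F face_of P" "?V \<inter> F = {}" for F
  proof
    show "P \<inter> f -` f ` F \<subseteq> F"
    proof
      fix x assume "x \<in> P \<inter> f -` f ` F"
      then obtain y where "x \<in> P" "y \<in> F" "f x = f y" by blast
      then show "x \<in> F" using inj[OF F] by blast
    qed
    show "F \<subseteq> P \<inter> f -` f ` F" using face_of_imp_subset[OF F(1)] by blast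
  qed
  have vimP: "P \<inter> f -` f ` P = P" by blast
  have fP: "f ` P face_of f ` P" using conv f(1) by (simp add: face_of_refl convex_linear_image)
  show ?thesis
  proof (rule order_iso_onI[where h = "\<lambda>G. P \<inter> f -` G" and k = "\<lambda>F. f ` F"])
    fix G assume "G \<in> {G. G face_of f ` P}"
    then have G: "G face_of f ` P" by (rule CollectD)
    have sub: "G \<subseteq> f ` P" using G by (rule face_of_imp_subset)
    then show "f ` (P \<inter> f -` G) = G" by blast
    show "P \<inter> f -` G \<in> {F. F face_of P \<and> ?V \<inter> F = {}} \<union> {P}"
    proof (cases "G = f ` P")
      case True
      then show ?thesis using vimP by simp
    next
      case False
      then have "q \<notin> G" using face_of_disjoint_rel_interior[OF G] b(2) by blast
      moreover have "f v = q" if "v \<in> ?V" for v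
        using b(3) that by (simp add: vertices_def extreme_point_of_def)
      ultimately have "?V \<inter> (P \<inter> f -` G) = {}" by blast
      then show ?thesis using face_of_vimage_Int[OF f(1) conv G] by simp
    qed
  next
    fix F assume "F \<in> {F. F face_of P \<and> ?V \<inter> F = {}} \<union> {P}"
    then consider "F face_of P" "?V \<inter> F = {}" | "F = P" by blast
    then show "f ` F \<in> {G. G face_of f ` P}" "P \<inter> f -` f ` F = F"
      using face vim fP vimP by (cases; simp)+
  next
    show "P \<inter> f -` G \<subseteq> P \<inter> f -` G'" if "G \<subseteq> G'" for G G' using that by blast
    show "f ` F \<subseteq> f ` F'" if "F \<subseteq> F'" for F F' using that by (rule image_mono)
  qed
qed

text \<open>The points of \<open>V\<close> are atoms of the face lattice and thus correspond to
  vertices of \<open>P\<close>; facets are maximal proper faces and inherit the count. Affine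
  independence, not visible in the lattice as such, is then derived from these counts.\<close>

lemma special_simplex_transfer:
  fixes P :: "'a::euclidean_space set" and V :: "'b::euclidean_space set"
  assumes P: "polytope P" "1 \<le> aff_dim P" and w: "wedge D V K" and card: "card V = Suc m"
    and iso: "P \<cong>\<^sub>F convex hull (V \<union> K)"
  shows "\<exists>S. special_simplex m S P \<and>
    order_iso_on ({F. F face_of P \<and> vertices S \<inter> F = {}} \<union> {P})
      ({F. F face_of convex hull (V \<union> K) \<and> V \<inter> F = {}} \<union> {convex hull (V \<union> K)})"
proof (rule order_iso_on_top[OF iso[unfolded face_lattice_iso_iff] polytope_imp_convex[OF P(1)] convex_convex_hull])
  let ?R = "convex hull (V \<union> K)"
  note W = wedgeD[OF w]
  have conv: "convex P" using P(1) by (rule polytope_imp_convex)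
  fix h k
  assume h: "\<And>F. F face_of P \<Longrightarrow> h F face_of ?R" "\<And>F. F face_of P \<Longrightarrow> k (h F) = F"
    and k: "\<And>G. G face_of ?R \<Longrightarrow> k G face_of P" "\<And>G. G face_of ?R \<Longrightarrow> h (k G) = G"
    and hm: "\<And>F F'. F face_of P \<Longrightarrow> F' face_of P \<Longrightarrow> F \<subseteq> F' \<longleftrightarrow> h F \<subseteq> h F'"
    and km: "\<And>G G'. G face_of ?R \<Longrightarrow> G' face_of ?R \<Longrightarrow> G \<subseteq> G' \<longleftrightarrow> k G \<subseteq> k G'"
    and top: "h P = ?R" "k ?R = P" and h0: "h {} = {}"
  have k0: "k {} = {}" using h(2)[OF empty_face_of] by (simp only: h0)
  \<comment> \<open>The face corresponding to the atom \<open>{r}\<close> is nonempty, and any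
    vertex of it already corresponds to \<open>{r}\<close>.\<close>
  have "\<exists>x. {x} face_of P \<and> h {x} = {r}" if r: "r \<in> V" for r
  proof -
    have r': "{r} face_of ?R" by (rule wedge_singleton_face[OF w r])
    have "k {r} \<noteq> {}" using k(2)[OF r'] h0 by auto
    moreover have "polytope (k {r})" by (rule face_of_polytope_polytope[OF P(1) k(1)[OF r']])
    then have "k {r} = convex hull (vertices (k {r}))" by (rule polytope_eq_convex_hull_vertices)
    ultimately obtain x where "x \<in> vertices (k {r})" by (metis all_not_in_conv convex_hull_eq_empty)
    then have x: "{x} face_of P" "{x} \<subseteq> k {r}"
      using extreme_point_of_face[OF k(1)[OF r']] by (simp_all add: vertices_def face_of_singleton)
    have "h {x} \<subseteq> h (k {r})" using x(2) by (rule iffD1[OF hm[OF x(1) k(1)[OF r']]])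
    then have "h {x} \<subseteq> {r}" by (simp only: k(2)[OF r'])
    moreover have "h {x} \<noteq> {}" using h(2)[OF x(1)] k0 by auto
    ultimately show ?thesis using x(1) by blast
  qed
  then obtain \<nu> where \<nu>: "\<And>r. r \<in> V \<Longrightarrow> {\<nu> r} face_of P" "\<And>r. r \<in> V \<Longrightarrow> h {\<nu> r} = {r}" by metis
  have inj: "inj_on \<nu> V" using \<nu>(2) by (intro inj_onI) (metis singleton_inject)
  let ?V = "\<nu> ` V"
  have Int: "?V \<inter> F = \<nu> ` (V \<inter> h F)" if F: "F face_of P" for F
  proof -
    have "\<nu> r \<in> F \<longleftrightarrow> r \<in> h F" if "r \<in> V" for r
      using hm[OF \<nu>(1)[OF that] F] \<nu>(2)[OF that] by simp
    then show ?thesis by blast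
  qed
  have card_Int: "card (?V \<inter> F) = card (V \<inter> h F)" if F: "F face_of P" for F
    unfolding Int[OF F] by (rule card_image) (rule inj_on_subset[OF inj Int_lower1])
  have cardV: "card ?V = Suc m" using inj card by (simp add: card_image)
  have Vv: "?V \<subseteq> vertices P" using \<nu>(1) by (auto simp: vertices_def face_of_singleton)
  have fac: "card (?V \<inter> F) = m" if F: "F facet_of P" for F
  proof -
    have F': "F face_of P" using F by (rule facet_of_imp_face_of)
    have "card (V \<inter> h F) = card V - 1"
    proof (rule wedge_coatom[OF w h(1)[OF F']])
      have "F \<noteq> P" using F by auto
      then show "h F \<noteq> ?R" using h(2)[OF F'] top(2) by auto
      fix G assume G: "G face_of ?R" "h F \<subseteq> G" "G \<noteq> ?R"
      have "k (h F) \<subseteq> k G" using G(2) by (rule iffD1[OF km[OF h(1)[OF F'] G(1)]])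
      then have "F \<subseteq> k G" by (simp only: h(2)[OF F'])
      moreover have "k G \<noteq> P" using k(2)[OF G(1)] top(1) G(3) by auto
      ultimately have "k G = F" using facet_of_maximal[OF conv F k(1)[OF G(1)]] by blast
      then show "G = h F" using k(2)[OF G(1)] by simp
    qed
    then show ?thesis using card card_Int[OF F'] by simp
  qed
  have fin: "finite ?V" using W(2) by (rule finite_imageI)
  \<comment> \<open>Some facet misses a given vertex \<open>v\<close>, hence contains all the
    others. A dependence would put \<open>v\<close> into the affine hull of that facet, which meets
    \<open>P\<close> only in the facet.\<close>
  have aff: "\<not> affine_dependent ?V"
  proof
    assume "affine_dependent ?V"
    then obtain v where v: "v \<in> ?V" "v \<in> affine hull (?V - {v})" unfolding affine_dependent_def by blast
    have vP: "v \<in> vertices P" using v(1) Vv by blast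
    obtain F where F: "F facet_of P" "v \<notin> F"
    proof (rule facet_avoiding_vertex[OF P vP empty_face_of])
      show "v \<notin> {}" by simp
    qed (rule that)
    have "?V \<inter> F = ?V - {v}"
    proof (rule card_subset_eq)
      show "finite (?V - {v})" using fin by simp
      show "?V \<inter> F \<subseteq> ?V - {v}" using F(2) by blast
      show "card (?V \<inter> F) = card (?V - {v})"
        using fin cardV v(1) fac[OF F(1)] by (simp add: card_Diff_singleton)
    qed
    then have "?V - {v} \<subseteq> F" by blast
    then have "v \<in> affine hull F" using v(2) hull_mono by blast
    moreover have "v \<in> P" using vP by (simp add: vertices_def extreme_point_of_def)
    ultimately have "v \<in> F"
      using face_of_imp_eq_affine_Int[OF conv facet_of_imp_face_of[OF F(1)]] by blast
    then show False using F(2) by blast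
  qed
  note vert = vertices_convex_hull_affine_independent[OF aff]
  have "special_simplex m (convex hull ?V) P"
    unfolding special_simplex_def vert
    using simplex_convex_hull[of ?V "int m"] aff cardV Vv fac by simp
  moreover have "order_iso_on ({F. F face_of P \<and> ?V \<inter> F = {}} \<union> {P})
      ({F. F face_of ?R \<and> V \<inter> F = {}} \<union> {?R})"
  proof (rule order_iso_onI[where h = h and k = k])
    have P': "P face_of P" "?R face_of ?R" using conv by (simp_all add: face_of_refl)
    have fP: "F face_of P" if "F \<in> {F. F face_of P \<and> ?V \<inter> F = {}} \<union> {P}" for F
      using that P' by blast
    fix F assume F: "F \<in> {F. F face_of P \<and> ?V \<inter> F = {}} \<union> {P}"
    show "k (h F) = F" by (rule h(2)[OF fP[OF F]])
    show "h F \<in> {F. F face_of ?R \<and> V \<inter> F = {}} \<union> {?R}"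
      using F Int[OF fP[OF F]] h(1)[OF fP[OF F]] top(1) by auto
    show "h F \<subseteq> h F'" if "F' \<in> {F. F face_of P \<and> ?V \<inter> F = {}} \<union> {P}" "F \<subseteq> F'" for F'
      using that(2) by (rule iffD1[OF hm[OF fP[OF F] fP[OF that(1)]]])
  next
    have P': "P face_of P" "?R face_of ?R" using conv by (simp_all add: face_of_refl)
    have fR: "F face_of ?R" if "F \<in> {F. F face_of ?R \<and> V \<inter> F = {}} \<union> {?R}" for F
      using that P' by blast
    fix F assume F: "F \<in> {F. F face_of ?R \<and> V \<inter> F = {}} \<union> {?R}"
    show hk: "h (k F) = F" by (rule k(2)[OF fR[OF F]])
    show "k F \<in> {F. F face_of P \<and> ?V \<inter> F = {}} \<union> {P}"
      using F Int[OF k(1)[OF fR[OF F]]] k(1)[OF fR[OF F]] top(2) unfolding hk by auto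
    show "k F \<subseteq> k F'" if "F' \<in> {F. F face_of ?R \<and> V \<inter> F = {}} \<union> {?R}" "F \<subseteq> F'" for F'
      using that(2) by (rule iffD1[OF km[OF fR[OF F] fR[OF that(1)]]])
  qed
  ultimately show ?thesis by (intro exI[of _ "convex hull ?V"]) (simp add: vert)
qed

lemma translated_Times_face_lattice_iso:
  fixes Q :: "'a::euclidean_space set"
  assumes "convex Q"
  shows "Q \<cong>\<^sub>F {0::'b::euclidean_space} \<times> (+) a ` Q" "aff_dim ({0::'b} \<times> (+) a ` Q) = aff_dim Q"
proof -
  let ?g = "\<lambda>y::'a. (0::'b, y)"
  have g: "linear ?g" "inj ?g" by (auto simp: linear_iff inj_def)
  have eq: "{0} \<times> (+) a ` Q = ?g ` (+) a ` Q" by auto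
  have "(+) a ` Q \<cong>\<^sub>F ?g ` (+) a ` Q"
    using assms by (intro face_lattice_iso_linear_image g(1) inj_on_subset[OF g(2)]) (auto intro: convex_translation)
  then show "Q \<cong>\<^sub>F {0::'b} \<times> (+) a ` Q"
    unfolding eq by (rule face_lattice_iso_trans[OF face_lattice_iso_translation])
  show "aff_dim ({0::'b} \<times> (+) a ` Q) = aff_dim Q"
    unfolding eq aff_dim_injective_linear_image[OF g] by (rule aff_dim_translation_eq)
qed

text \<open>The basis polytope of the transferred simplex has the face lattice of \<open>Q\<close>,
  since in both cases the proper faces correspond to the faces avoiding the simplex. It can replace
  \<open>Q\<close> in the construction without changing the combinatorial type.\<close>

lemma iso_pyr_simplex_sum_imp_basis_polytope:
  fixes P Q :: "'a::euclidean_space set"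
  assumes P: "polytope P" "1 \<le> aff_dim P" and Q: "polytope Q" and j: "0 < j"
    and R: "pyr_simplex_sum i j Q R" and iso: "P \<cong>\<^sub>F R"
  shows "\<exists>S (Q' :: 'a set) R'. special_simplex (i + j) S P \<and> basis_polytope P S Q' \<and>
    aff_dim Q' = aff_dim P - int (i + j) \<and> pyr_simplex_sum i j Q' R' \<and> P \<cong>\<^sub>F R'"
proof -
  obtain D V a where w: "wedge D V ({0} \<times> (+) a ` Q)" and RV: "R = convex hull (V \<union> {0} \<times> (+) a ` Q)"
    and card: "card D = Suc j" "card V = Suc (i + j)"
    by (rule pyr_simplex_sum_imp_wedge[OF R Q j]) (rule that)
  let ?K = "{0::'a} \<times> (+) a ` Q"
  obtain S where S: "special_simplex (i + j) S P" and
    av: "order_iso_on ({F. F face_of P \<and> vertices S \<inter> F = {}} \<union> {P})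
      ({F. F face_of convex hull (V \<union> ?K) \<and> V \<inter> F = {}} \<union> {convex hull (V \<union> ?K)})"
    using special_simplex_transfer[OF P w card(2) iso[unfolded RV]] by blast
  note s = special_simplexD[OF S]
  let ?V = "vertices S"
  have "S \<noteq> {}" using s(6) by auto
  then obtain v where v: "v \<in> S" by blast
  obtain f :: "'a \<Rightarrow> 'a" where f: "linear f" "{x. f x = 0} = span ((+) (- v) ` S)"
    by (rule linear_kernel_exists[OF subspace_span[of "(+) (- v) ` S"]]) (rule that)
  have "0 \<in> (+) (- v) ` S" using v by force
  then have "span ((+) (- v) ` S) = affine hull ((+) (- v) ` S)"
    by (intro affine_hull_span_0[symmetric] hull_inc)
  then have "{x. f x = 0} = (+) (- v) ` (affine hull S)" unfolding f(2) by (simp only: affine_hull_translation)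
  then have "(+) v ` {x. f x = 0} = affine hull S" by (simp add: image_image)
  then have par: "affine_parallel {x. f x = 0} (affine hull S)"
    unfolding affine_parallel_def by (intro exI[of _ v]) simp
  have basis: "basis_polytope P S (f ` P)"
    unfolding basis_polytope_def using f(1) par by blast
  have ne: "S \<noteq> {}" using v by blast
  obtain g q where g: "linear g" "f ` P = g ` P" "affine hull S = {x. g x = q}"
    by (rule basis_polytopeE[OF basis ne]) (rule that)
  note b = basis_polytope_dim_rel_interior[OF P(1) S g(1,3)]
  have Qp: "polytope (g ` P)" using g(1) P(1) by (rule polytope_linear_image)
  have "g ` P \<cong>\<^sub>F ?K"
    unfolding face_lattice_iso_iff
    by (rule order_iso_on_trans[OF order_iso_on_trans[OF basis_polytope_faces_iso[OF P S g(1,3)] av]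
          wedge_avoiding_faces_iso[OF w]])
  then have isoK: "?K \<cong>\<^sub>F g ` P" by (rule face_lattice_iso_sym)
  have "Suc j \<le> card ?V" using s(3) by simp
  \<comment> \<open>Any \<open>j + 1\<close> vertices, and any relative interior point of their
    hull, will do: the combinatorial type depends on the numbers only.\<close>
  then obtain D' where D': "D' \<subseteq> ?V" "card D' = Suc j" by (rule obtain_subset_with_card_n)
  have "convex hull D' \<noteq> {}" using D'(2) by auto
  then obtain c where c: "c \<in> rel_interior (convex hull D')"
    using rel_interior_eq_empty[OF convex_convex_hull] by blast
  have D2: "2 \<le> card D'" using D'(2) j by simp
  let ?K' = "{0::'a} \<times> (+) (- q) ` g ` P"
  let ?R' = "convex hull ((+) (- c) ` ?V \<times> {0} \<union> ?K')"
  note t = translated_wedge_product[OF s(1) D'(1) c D2 Qp b(2)]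
  have "card (?V - D') = i" "card D' - 1 = j"
    using D' s(2,3) by (simp_all add: card_Diff_subset finite_subset)
  then have pyr: "pyr_simplex_sum i j (g ` P) ?R'" using t(2) by simp
  have "?K \<cong>\<^sub>F ?K'"
    using isoK translated_Times_face_lattice_iso(1)[OF polytope_imp_convex[OF Qp]]
    by (rule face_lattice_iso_trans)
  then have "convex hull (V \<union> ?K) \<cong>\<^sub>F ?R'"
    by (rule wedge_face_lattice_iso[OF w t(1), rotated 2])
       (use card D'(2) s(3) in \<open>simp_all add: card_cartesian_product card_image\<close>)
  then have "P \<cong>\<^sub>F ?R'" using iso unfolding RV by (rule face_lattice_iso_trans[rotated])
  then show ?thesis using S basis[unfolded g(2)] b(1) pyr by blast
qed

text \<open>Everything is read off from the underlying configuration. The construction lives in a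
  product space; the last conclusion moves it into the original space when the dimension
  permits.\<close>

lemma pyr_simplex_sum_special_meek:
  fixes Q :: "'a::euclidean_space set"
  assumes R: "pyr_simplex_sum i j Q R" and Q: "polytope Q" and j: "0 < j"
  shows "polytope R" "aff_dim R = int (i + j) + aff_dim Q"
    "\<exists>S. special_simplex (i + j) S R \<and> meek R S"
    "aff_dim R \<le> int DIM('a) \<Longrightarrow> \<exists>P' S :: 'a set. polytope P' \<and> aff_dim P' = aff_dim R \<and> P' \<cong>\<^sub>F R \<and>
       special_simplex (i + j) S P' \<and> meek P' S"
proof -
  obtain D V a where w: "wedge D V ({0} \<times> (+) a ` Q)" and RV: "R = convex hull (V \<union> {0} \<times> (+) a ` Q)"
    and card: "card D = Suc j" "card V = Suc (i + j)"
    by (rule pyr_simplex_sum_imp_wedge[OF R Q j]) (rule that)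
  let ?K = "{0::'a} \<times> (+) a ` Q"
  note W = wedgeD[OF w]
  show "polytope R" unfolding RV by (rule W(18))
  show "aff_dim R = int (i + j) + aff_dim Q"
    unfolding RV wedge_aff_dim[OF w] translated_Times_face_lattice_iso(2)[OF polytope_imp_convex[OF Q]]
    using card(2) by simp
  show "\<exists>S. special_simplex (i + j) S R \<and> meek R S"
    unfolding RV using wedge_special_simplex[OF w card(2)] wedge_meek[OF w] by blast
  assume dim: "aff_dim R \<le> int DIM('a)"
  have "0 \<in> affine hull (V \<union> ?K)" using W(15) by (intro hull_inc) blast
  then have "aff_dim R = int (dim (span (V \<union> ?K)))"
    unfolding RV aff_dim_convex_hull dim_span by (rule aff_dim_zero)
  then have "dim (span (V \<union> ?K)) \<le> dim (UNIV :: 'a set)" using dim by simp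
  \<comment> \<open>A linear isometry on the span is injective there, so it carries the
    configuration along.\<close>
  then obtain g :: "'a \<times> 'a \<Rightarrow> 'a" where g: "linear g"
    "\<And>x. x \<in> span (V \<union> ?K) \<Longrightarrow> norm (g x) = norm x"
    by (rule isometry_subset_subspace[OF subspace_span subspace_UNIV]) (rule that)
  have inj: "inj_on g (span (V \<union> ?K))"
    unfolding linear_inj_on_iff_eq_0[OF g(1) subspace_span] using g(2) norm_eq_zero by metis
  note L = wedge_linear_image[OF w g(1) inj]
  have card': "card (g ` V) = Suc (i + j)" using L(3) card(2) by simp
  have "g ` R = convex hull (g ` V \<union> g ` ?K)" unfolding RV by (rule L(2)[symmetric])
  moreover have "aff_dim (convex hull (g ` V \<union> g ` ?K)) = aff_dim R"
  proof -
    have "inj_on g (span ?K)" using inj by (rule inj_on_subset) (rule span_mono, blast)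
    then have "dim (g ` ?K) = dim ?K" by (rule dim_image_eq[OF g(1)])
    moreover have "aff_dim (g ` ?K) = int (dim (g ` ?K))" "aff_dim ?K = int (dim ?K)"
      using wedgeD(15)[OF L(1)] W(15) by (simp_all only: aff_dim_zero hull_inc)
    ultimately show ?thesis unfolding RV wedge_aff_dim[OF w] wedge_aff_dim[OF L(1)] L(3) by simp
  qed
  moreover have "R \<cong>\<^sub>F g ` R"
    unfolding RV by (rule face_lattice_iso_linear_image[OF g(1) convex_convex_hull L(4)])
  ultimately show "\<exists>P' S :: 'a set. polytope P' \<and> aff_dim P' = aff_dim R \<and> P' \<cong>\<^sub>F R \<and>
       special_simplex (i + j) S P' \<and> meek P' S"
    using wedge_special_simplex[OF L(1) card'] wedge_meek[OF L(1)] wedgeD(18)[OF L(1)] face_lattice_iso_sym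
    by metis
qed

section \<open>Classification of the meek polytopes with a special simplex\<close>

theorem theorem5p1:
  fixes P :: "'a::euclidean_space set" and n m :: nat
  assumes "n_polytope n P" and "1 \<le> m"
  shows
    \<comment> \<open>every meek polytope with a special simplex has the stated form, for its own basis polytope\<close>
    "(\<forall>S (Q :: 'a set). special_simplex m S P \<and> meek P S \<and> basis_polytope P S Q \<longrightarrow>
        aff_dim Q = int n - int m \<and>
        (\<exists>i j R. 0 < j \<and> i + j = m \<and> pyr_simplex_sum i j Q R \<and> P \<cong>\<^sub>F R)) \<and>
    \<comment> \<open>every polytope of the stated form is itself meek with a special simplex\<close>
     (\<forall>(Q :: 'a set) i j R.
        polytope Q \<and> aff_dim Q = int n - int m \<and> 0 < j \<and> i + j = m \<and> pyr_simplex_sum i j Q R \<longrightarrow>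
        n_polytope n R \<and> (\<exists>S. special_simplex m S R \<and> meek R S)) \<and>
    \<comment> \<open>the equivalence, with polytopes identified up to isomorphism of face lattices\<close>
     ((\<exists>(P' :: 'a set) S. n_polytope n P' \<and> P' \<cong>\<^sub>F P \<and> special_simplex m S P' \<and> meek P' S) \<longleftrightarrow>
      (\<exists>S (Q :: 'a set). special_simplex m S P \<and> basis_polytope P S Q \<and>
        aff_dim Q = int n - int m \<and>
        (\<exists>i j R. 0 < j \<and> i + j = m \<and> pyr_simplex_sum i j Q R \<and> P \<cong>\<^sub>F R))) \<and>
    \<comment> \<open>the equality of classes, with polytopes identified up to isomorphism of face lattices\<close>
     ((\<exists>(P' :: 'a set) S. n_polytope n P' \<and> P' \<cong>\<^sub>F P \<and> special_simplex m S P' \<and> meek P' S) \<longleftrightarrow>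
      (\<exists>(Q :: 'a set) i j R. polytope Q \<and> aff_dim Q = int n - int m \<and>
        0 < j \<and> i + j = m \<and> pyr_simplex_sum i j Q R \<and> P \<cong>\<^sub>F R))"
proof -
  have P: "polytope P" "aff_dim P = int n" using assms(1) by (simp_all add: n_polytope_def)
  have ge: "1 \<le> aff_dim P'" if "polytope P'" "special_simplex m S P'" for P' S :: "'a set"
    using aff_dim_subset[OF special_simplex_subset[OF that(2) polytope_imp_convex[OF that(1)]]]
      special_simplexD(6)[OF that(2)] assms(2) by simp
  have dim_ge: "1 \<le> aff_dim P" if "polytope Q" "aff_dim Q = int n - int m"
    "pyr_simplex_sum i j Q R" for i j R and Q :: "'a set"
  proof -
    \<comment> \<open>A translate of \<open>Q\<close> has \<open>0\<close> in its relative interior,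
      so \<open>Q\<close> is nonempty, its dimension is not \<open>-1\<close>, and
      \<open>n \<ge> m\<close> follows.\<close>
    have "Q \<noteq> {}" using that(3) unfolding pyr_simplex_sum_def by auto
    then have "0 \<le> aff_dim Q" using aff_dim_negative_iff[of Q] by linarith
    then show ?thesis using that(2) P(2) assms(2) by linarith
  qed
  have decomposition: "aff_dim Q = int n - int m \<and>
      (\<exists>i j R. 0 < j \<and> i + j = m \<and> pyr_simplex_sum i j Q R \<and> P' \<cong>\<^sub>F R)"
    if P': "n_polytope n P'" and S: "special_simplex m S P'" and meek: "meek P' S"
      and Q: "basis_polytope P' S Q" for P' S Q :: "'a set"
  proof -
    have P': "polytope P'" "aff_dim P' = int n" using P' by (simp_all add: n_polytope_def)
    have ne: "S \<noteq> {}" using special_simplexD(6)[OF S] by auto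
    obtain f q where f: "linear f" "Q = f ` P'" "affine hull S = {x. f x = q}"
      by (rule basis_polytopeE[OF Q ne]) (rule that)
    have "aff_dim Q = int n - int m"
      using basis_polytope_dim_rel_interior(1)[OF P'(1) S f(1,3)] P'(2) unfolding f(2) by simp
    then show ?thesis
      using special_meek_imp_pyr_simplex_sum[OF P'(1) ge[OF P'(1) S] assms(2) S meek Q] by blast
  qed
  \<comment> \<open>Meekness depends on the realisation and not only on the face lattice, hence the
    representative \<open>P'\<close>.\<close>
  let ?A = "\<exists>(P' :: 'a set) S. n_polytope n P' \<and> P' \<cong>\<^sub>F P \<and> special_simplex m S P' \<and> meek P' S"
  let ?B = "\<exists>S (Q :: 'a set). special_simplex m S P \<and> basis_polytope P S Q \<and>
    aff_dim Q = int n - int m \<and>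
    (\<exists>i j R. 0 < j \<and> i + j = m \<and> pyr_simplex_sum i j Q R \<and> P \<cong>\<^sub>F R)"
  let ?C = "\<exists>(Q :: 'a set) i j R. polytope Q \<and> aff_dim Q = int n - int m \<and>
    0 < j \<and> i + j = m \<and> pyr_simplex_sum i j Q R \<and> P \<cong>\<^sub>F R"
  have basis_polytope_polytope: "polytope Q" if "polytope P'" "basis_polytope P' S Q" for P' S Q :: "'a set"
    using that polytope_linear_image unfolding basis_polytope_def by blast
  have AC: ?C if A: ?A
  proof -
    obtain P' S :: "'a set" where P': "n_polytope n P'" "P' \<cong>\<^sub>F P" "special_simplex m S P'" "meek P' S"
      using A by blast
    obtain Q :: "'a set" where Q: "basis_polytope P' S Q" using P'(4) unfolding meek_def by blast
    obtain i j R where R: "0 < j" "i + j = m" "pyr_simplex_sum i j Q R" "P' \<cong>\<^sub>F R"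
      and dim: "aff_dim Q = int n - int m"
      using decomposition[OF P'(1,3,4) Q] by blast
    have "polytope P'" using P'(1) by (simp add: n_polytope_def)
    then have "polytope Q" using Q by (rule basis_polytope_polytope)
    moreover have "P \<cong>\<^sub>F R" using face_lattice_iso_sym[OF P'(2)] R(4) by (rule face_lattice_iso_trans)
    ultimately show ?thesis using R dim by blast
  qed
  have CA: ?A if C: ?C
  proof -
    obtain Q :: "'a set" and i j R where Q: "polytope Q" "aff_dim Q = int n - int m" and j: "0 < j"
      and ij: "i + j = m" and R: "pyr_simplex_sum i j Q R" "P \<cong>\<^sub>F R" using C by blast
    note r = pyr_simplex_sum_special_meek[OF R(1) Q(1) j, unfolded ij]
    have dimR: "aff_dim R = int n" using r(2) Q(2) by simp
    \<comment> \<open>\<open>R\<close> has the dimension of \<open>P\<close>, so the ambient space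
      of \<open>P\<close> has room for a meek representative.\<close>
    then have "aff_dim R \<le> int DIM('a)" using aff_dim_le_DIM[of P] P(2) by simp
    from r(4)[OF this] obtain P' S :: "'a set" where P': "polytope P'" "aff_dim P' = aff_dim R"
      "P' \<cong>\<^sub>F R" "special_simplex m S P'" "meek P' S" by blast
    have "n_polytope n P'" using P'(1,2) dimR by (simp add: n_polytope_def)
    moreover have "P' \<cong>\<^sub>F P" using P'(3) face_lattice_iso_sym[OF R(2)] by (rule face_lattice_iso_trans)
    ultimately show ?thesis using P'(4,5) by blast
  qed
  have CB: ?B if C: ?C
  proof -
    obtain Q :: "'a set" and i j R where Q: "polytope Q" "aff_dim Q = int n - int m" and j: "0 < j"
      and ij: "i + j = m" and R: "pyr_simplex_sum i j Q R" "P \<cong>\<^sub>F R" using C by blast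
    obtain S Q' :: "'a set" and R' where "special_simplex m S P" "basis_polytope P S Q'"
      "aff_dim Q' = aff_dim P - int m" "pyr_simplex_sum i j Q' R'" "P \<cong>\<^sub>F R'"
      using iso_pyr_simplex_sum_imp_basis_polytope[OF P(1) dim_ge[OF Q R(1)] Q(1) j R] unfolding ij by blast
    then show ?thesis using j ij unfolding P(2) by blast
  qed
  have BC: ?C if B: ?B
    using B basis_polytope_polytope[OF P(1)] by blast
  have converse: "n_polytope n R \<and> (\<exists>S. special_simplex m S R \<and> meek R S)"
    if "polytope Q" "aff_dim Q = int n - int m" "0 < j" "i + j = m" "pyr_simplex_sum i j Q R"
    for i j R and Q :: "'a set"
    using pyr_simplex_sum_special_meek(1-3)[OF that(5,1,3)] that(2,4) by (simp add: n_polytope_def)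
  show ?thesis
  proof (intro conjI[OF _ conjI[OF _ conjI]])
    show "?A \<longleftrightarrow> ?B" by (rule iffI[OF CB[OF AC] CA[OF BC]])
    show "?A \<longleftrightarrow> ?C" by (rule iffI[OF AC CA])
  qed (use decomposition[OF assms(1)] converse in blast)+
qed

end
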